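(* Let $n\ge 1$ be an integer, let $1<p<\infty$ with $1/p+1/p'=1$, and let $\alpha,\beta$ be real numbers with $0<\alpha+\beta<n$, $\alpha<n/p$ and $\beta<n/p'$. Then for every $g\in\mathcal{S}(\mathbb{R}^n)$, $$\big\|\,|x|^{-\alpha}g\big\|_{L^p(\mathbb{R}^n)}\le 2^{-(\alpha+\beta)}\left[\frac{\Gamma\big(\frac{n}{2p}-\frac{\alpha}{2}\big)\,\Gamma\big(\frac{n}{2p'}-\frac{\beta}{2}\big)}{\Gamma\big(\frac{n}{2p'}+\frac{\alpha}{2}\big)\,\Gamma\big(\frac{n}{2p}+\frac{\beta}{2}\big)}\right]\big\|\,|x|^{\beta}(-\Delta)^{(\alpha+\beta)/2}g\big\|_{L^p(\mathbb{R}^n)}.$$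
   Context: $\mathcal{S}(\mathbb{R}^n)$ is the Schwartz class. The Fourier transform is $\hat f(y)=\int_{\mathbb{R}^n}e^{2\pi i x\cdot y}f(x)\,dx$. $\Delta$ is the Laplacian on $\mathbb{R}^n$, and for $s\ge0$ the operator $(-\Delta)^{s/2}$ is the Fourier multiplier operator with symbol $(2\pi|y|)^{s}$. $\Gamma$ is the Euler Gamma function. *)

theory Defs
  imports "HOL-Analysis.Analysis"
begin

primrec iterated_partial ::
    "'a::euclidean_space list \<Rightarrow> ('a \<Rightarrow> complex) \<Rightarrow> 'a \<Rightarrow> complex" where
  "iterated_partial [] f = f"
| "iterated_partial (b # bs) f =
     (\<lambda>x. frechet_derivative (iterated_partial bs f) (at x) b)"

text \<open>
  The lists of basis vectors play the role of multi-indices (with every order of differentiation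
  allowed). Differentiability of all iterated partial derivatives makes each of them continuous,
  so the first conjunct says that the function is of class $C^\infty$; without it
  \<^const>\<open>frechet_derivative\<close> would be an unspecified value.
\<close>
definition schwartz :: "('a::euclidean_space \<Rightarrow> complex) set" where
  "schwartz = {f. \<forall>bs. set bs \<subseteq> Basis \<longrightarrow>
      (\<forall>x. iterated_partial bs f differentiable (at x)) \<and>
      (\<forall>k::nat. bounded (range (\<lambda>x. norm x ^ k *\<^sub>R iterated_partial bs f x)))}"

text \<open>
  The Fourier transform carries the positive sign in the exponent, so its inverse carries the
  negative one.
\<close>
definition fourier :: "('a::euclidean_space \<Rightarrow> complex) \<Rightarrow> 'a \<Rightarrow> complex" where
  "fourier f y = (LINT x|lborel. exp (2 * of_real pi * \<i> * of_real (x \<bullet> y)) * f x)"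

definition inverse_fourier :: "('a::euclidean_space \<Rightarrow> complex) \<Rightarrow> 'a \<Rightarrow> complex" where
  "inverse_fourier h x = (LINT y|lborel. exp (- (2 * of_real pi * \<i> * of_real (x \<bullet> y))) * h y)"

definition fourier_multiplier ::
    "('a::euclidean_space \<Rightarrow> complex) \<Rightarrow> ('a \<Rightarrow> complex) \<Rightarrow> 'a \<Rightarrow> complex" where
  "fourier_multiplier m f = inverse_fourier (\<lambda>y. m y * fourier f y)"

text \<open>
  \<open>frac_laplacian s\<close> is $(-\Delta)^{s/2}$ (note the halved exponent), for \<open>s \<ge> 0\<close>. For \<open>s = 0\<close>
  the symbol is 1 except at the origin, where \<open>0 powr 0 = 0\<close>; this is a null set.
\<close>
definition frac_laplacian ::
    "real \<Rightarrow> ('a::euclidean_space \<Rightarrow> complex) \<Rightarrow> 'a \<Rightarrow> complex" where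
  "frac_laplacian s = fourier_multiplier (\<lambda>y. of_real ((2 * pi * norm y) powr s))"

text \<open>
  The $L^p$ norm for \<open>0 < p < \<infinity>\<close>, with value \<open>\<infinity>\<close> for measurable functions outside $L^p$.
\<close>
definition Lp_norm :: "real \<Rightarrow> ('a::euclidean_space \<Rightarrow> complex) \<Rightarrow> ennreal" where
  "Lp_norm p f =
     (let I = (\<integral>\<^sup>+ x. ennreal (norm (f x) powr p) \<partial>lborel)
      in if I = \<infinity> then \<infinity> else ennreal (enn2real I powr (1 / p)))"

end

theory Submission
  imports Defs "HOL-Probability.Probability"
begin

text \<open>
  Write $s = \alpha + \beta$ and $h = (-\Delta)^{s/2} g$. The inequality is the sharp Stein--Weiss
  bound for the Riesz potential that recovers $g$ from $h$, and it rests on two facts.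

  First, $|g(x)| \le c \int |x-y|^{s-n} |h(y)|\,dy$ with
  $c = \Gamma(\frac{n-s}2) / (\pi^{n/2} 2^s \Gamma(\frac s2))$ (\<open>norm_le_riesz_potential\<close>). Both the
  Riesz kernel and the inverse of the symbol $(2\pi|\xi|)^s$ are, up to constants, averages over $t$, with weight
  $t^{s/2-1}$, of the heat kernel $t^{-n/2} e^{-\pi|x|^2/t}$ and of its Fourier transform
  $e^{-\pi t|\xi|^2}$ respectively. Hence averaging the heat flow of $h$ over $t$ gives a multiple of
  the inverse Fourier transform of $\hat g$, which is $g$. Since only an upper bound for $|g|$ is
  wanted, absolute values are taken inside the $t$-average; Tonelli's theorem then produces the
  Riesz potential of $|h|$, finite or not.

  Second, the kernel $|x|^{-\alpha}|x-y|^{s-n}|y|^{-\beta}$ is homogeneous of degree $-n$, so Schur's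
  test with the weight $|y|^{-n/(pp')}$ applies (\<open>stein_weiss_schur\<close>). The row and the column integrals
  are both convolutions of two power functions, hence given by the composition formula for Riesz
  kernels (\<open>riesz_kernel_convolution\<close>), and they carry the same constant $A$. The formula itself follows
  from the semigroup law of the heat kernel and Euler's Beta integral. The product $cA$
  is the constant in the theorem.
\<close>

section \<open>Gamma integrals and Gaussians\<close>

lemma nn_integral_power_exp:
  fixes a c :: real
  assumes a: "a > 0" and c: "c > 0"
  shows "(\<integral>\<^sup>+t\<in>{0<..}. ennreal (t powr (a - 1) * exp (- (c * t))) \<partial>lborel) = ennreal (Gamma a / c powr a)"
proof -
  have "ennreal (Gamma a) = (\<integral>\<^sup>+t. ennreal (t powr (a - 1) / exp t) * indicator {0..} t \<partial>lborel)"
    using nn_integral_has_integral_lebesgue'[OF _ Gamma_integral_real[OF a]] by simp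
  also have "\<dots> = ennreal c * (\<integral>\<^sup>+t. ennreal ((c * t) powr (a - 1) / exp (c * t)) * indicator {0..} (c * t) \<partial>lborel)"
    using c by (subst nn_integral_real_affine[where c=c and t=0]) auto
  also have "(\<integral>\<^sup>+t. ennreal ((c * t) powr (a - 1) / exp (c * t)) * indicator {0..} (c * t) \<partial>lborel)
     = (\<integral>\<^sup>+t. ennreal (c powr (a - 1)) * (ennreal (t powr (a - 1) * exp (- (c * t))) * indicator {0<..} t) \<partial>lborel)"
    using c by (intro nn_integral_cong)
      (auto simp: indicator_def powr_mult exp_minus field_simps zero_le_mult_iff ennreal_mult'[symmetric])
  also have "\<dots> = ennreal (c powr (a - 1)) * (\<integral>\<^sup>+t\<in>{0<..}. ennreal (t powr (a - 1) * exp (- (c * t))) \<partial>lborel)"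
    by (rule nn_integral_cmult) auto
  finally have *: "ennreal (Gamma a) = ennreal c * (ennreal (c powr (a - 1)) * (\<integral>\<^sup>+t\<in>{0<..}. ennreal (t powr (a - 1) * exp (- (c * t))) \<partial>lborel))"
    (is "_ = _ * (_ * ?I)") .
  have "ennreal (Gamma a / c powr a) = ennreal (1 / c powr a) * ennreal (Gamma a)"
    by (simp add: ennreal_mult'[symmetric])
  also have "\<dots> = ennreal (1 / c powr a * c * c powr (a - 1)) * ?I"
    using c by (simp add: * mult.assoc[symmetric] ennreal_mult'[symmetric])
  also have "1 / c powr a * c * c powr (a - 1) = 1"
    using c by (simp add: powr_diff)
  finally show ?thesis by simp
qed

text \<open>
  The Gamma integral under the substitution $t \mapsto 1/t$. This form turns averages of heat kernels
  in $t$ into powers of the space variable; the direct form does the same on the Fourier side.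
\<close>
lemma nn_integral_power_exp_inverse:
  fixes a c :: real
  assumes a: "a > 0" and c: "c > 0"
  shows "(\<integral>\<^sup>+t\<in>{0<..}. ennreal (t powr (- a - 1) * exp (- (c / t))) \<partial>lborel) = ennreal (Gamma a / c powr a)"
proof -
  define f where "f = (\<lambda>t::real. t powr (a - 1) * exp (- (c * t)))"
  define S where "S = ({0<..} :: real set)"
  have S: "S \<in> sets lebesgue" by (simp add: S_def)
  have "((\<lambda>t. f t * indicator S t) has_integral (Gamma a / c powr a)) UNIV"
  proof -
    have "(\<integral>\<^sup>+t. ennreal (f t * indicator S t) \<partial>lborel) = ennreal (Gamma a / c powr a)"
      using nn_integral_power_exp[OF a c]
      by (simp add: f_def S_def ennreal_mult' ennreal_indicator)
    then show ?thesis
      using a c by (intro nn_integral_has_integral) (auto simp: f_def S_def Gamma_real_pos less_imp_le)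
  qed
  then have fi: "(f has_integral (Gamma a / c powr a)) S"
    using has_integral_restrict_UNIV[of S f "Gamma a / c powr a"]
    by (simp add: indicator_times_eq_if)
  have "f absolutely_integrable_on S"
    using fi by (intro nonnegative_absolutely_integrable_1) (auto simp: f_def has_integral_integrable)
  moreover have img: "(\<lambda>t. 1 / t) ` S = S"
  proof
    show "S \<subseteq> (\<lambda>t. 1 / t) ` S"
    proof
      fix t assume "t \<in> S"
      then show "t \<in> (\<lambda>t. 1 / t) ` S" by (intro image_eqI[of _ _ "1 / t"]) (auto simp: S_def)
    qed
  qed (auto simp: S_def)
  ultimately have "(\<lambda>x. \<bar>- (1 / x\<^sup>2)\<bar> * f (1 / x)) absolutely_integrable_on S \<and>
           integral S (\<lambda>x. \<bar>- (1 / x\<^sup>2)\<bar> * f (1 / x)) = Gamma a / c powr a"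
    using fi
    by (subst has_absolute_integral_change_of_variables_1'[OF S])
       (auto simp: S_def inj_on_def power2_eq_square integral_unique intro!: derivative_eq_intros)
  then have "((\<lambda>x. \<bar>- (1 / x\<^sup>2)\<bar> * f (1 / x)) has_integral (Gamma a / c powr a)) S"
    by (metis has_integral_integral set_lebesgue_integral_eq_integral(1))
  then have "(\<integral>\<^sup>+t. ennreal (\<bar>- (1 / t\<^sup>2)\<bar> * f (1 / t)) * indicator S t \<partial>lborel) = ennreal (Gamma a / c powr a)"
    by (intro nn_integral_has_integral_lebesgue') (auto simp: f_def)
  moreover have "\<bar>- (1 / t\<^sup>2)\<bar> * f (1 / t) = t powr (- a - 1) * exp (- (c / t))" if "t > 0" for t
  proof -
    have "1 / t\<^sup>2 = t powr (-2)" using that by (simp add: powr_minus_divide)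
    moreover have "(1 / t) powr (a - 1) = t powr (1 - a)"
      using that by (simp add: powr_divide powr_minus_divide[symmetric])
    moreover have "t powr (-2) * t powr (1 - a) = t powr (- a - 1)"
    proof -
      have "-2 + (1 - a) = - a - 1" by simp
      then show ?thesis by (simp only: powr_add[symmetric])
    qed
    ultimately show ?thesis using that by (simp add: f_def mult.assoc[symmetric])
  qed
  then have "(\<integral>\<^sup>+t. ennreal (\<bar>- (1 / t\<^sup>2)\<bar> * f (1 / t)) * indicator S t \<partial>lborel)
     = (\<integral>\<^sup>+t\<in>S. ennreal (t powr (- a - 1) * exp (- (c / t))) \<partial>lborel)"
    by (intro nn_integral_cong) (auto simp: S_def indicator_def)
  ultimately show ?thesis by (simp add: S_def)
qed

text \<open>
  The scaling is chosen so that the total mass is 1 and the Fourier transform is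
  $e^{-\pi t|\xi|^2}$; the usual heat kernel at time $\tau$ is \<open>heat (4 * pi * \<tau>)\<close>.
\<close>
definition heat :: "real \<Rightarrow> 'a::euclidean_space \<Rightarrow> real" where
  "heat t x = exp (- (pi * (norm x)\<^sup>2 / t)) / t powr (real DIM('a) / 2)"

lemma measurable_heat[measurable (raw)]:
  assumes [measurable]: "f \<in> borel_measurable M" "g \<in> borel_measurable M"
  shows "(\<lambda>x. heat (f x) (g x)) \<in> borel_measurable M"
  unfolding heat_def by measurable

lemma heat_nonneg[simp]: "0 \<le> heat t x" by (simp add: heat_def)

lemma heat_minus_commute: "heat t (x - y) = heat t (y - x)" by (simp add: heat_def norm_minus_commute)

text \<open>
  A rescaling of the characteristic function of the standard normal distribution.
\<close>
lemma gaussian_fourier_real: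
  fixes t y :: real
  assumes t: "t > 0"
  shows "has_bochner_integral lborel (\<lambda>x. complex_of_real (exp (- (pi * x\<^sup>2 / t)) ) * exp (2 * of_real pi * \<i> * of_real (x * y)))
     (complex_of_real (sqrt t * exp (- (pi * t * y\<^sup>2))))"
proof -
  define s where "s = y * sqrt (2 * pi * t)"
  define c where "c = sqrt (2 * pi / t)"
  have c: "c > 0" using t by (simp add: c_def)
  have sc: "s * c = 2 * pi * y" proof -
    have "sqrt (2 * pi * t) * sqrt (2 * pi / t) = sqrt ((2 * pi)\<^sup>2)"
      using t by (simp add: real_sqrt_mult[symmetric] power2_eq_square)
    also have "\<dots> = 2 * pi" by (rule real_sqrt_unique) auto
    finally show ?thesis by (simp add: s_def c_def mult.assoc)
  qed
  interpret real_distribution std_normal_distribution by (rule real_dist_normal_dist)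
  have int: "integrable std_normal_distribution (\<lambda>x. iexp (s * x))"
    by (rule integrable_iexp) auto
  have "(LINT x|std_normal_distribution. iexp (s * x)) = complex_of_real (exp (- (s^2) / 2))"
    using fun_cong[OF char_std_normal_distribution, of s] by (simp add: char_def)
  then have "has_bochner_integral std_normal_distribution (\<lambda>x. iexp (s * x)) (complex_of_real (exp (- (s^2) / 2)))"
    using int by (simp add: has_bochner_integral_iff)
  then have "has_bochner_integral lborel (\<lambda>x. std_normal_density x *\<^sub>R iexp (s * x)) (complex_of_real (exp (- (s^2) / 2)))"
    by (simp add: has_bochner_integral_iff integrable_density integral_density normal_density_nonneg)
  then have "has_bochner_integral lborel (\<lambda>x. std_normal_density (0 + c * x) *\<^sub>R iexp (s * (0 + c * x))) (complex_of_real (exp (- (s^2) / 2)) /\<^sub>R \<bar>c\<bar>)"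
    using c by (subst (asm) lborel_has_bochner_integral_real_affine_iff[of c _ _ 0]) auto
  then have "has_bochner_integral lborel (\<lambda>x. sqrt (2 * pi) *\<^sub>R (std_normal_density (0 + c * x) *\<^sub>R iexp (s * (0 + c * x)))) (sqrt (2 * pi) *\<^sub>R (complex_of_real (exp (- (s^2) / 2)) /\<^sub>R \<bar>c\<bar>))"
    by (intro has_bochner_integral_scaleR_right)
  moreover have "sqrt (2 * pi) *\<^sub>R (std_normal_density (0 + c * x) *\<^sub>R iexp (s * (0 + c * x)))
     = complex_of_real (exp (- (pi * x\<^sup>2 / t)) ) * exp (2 * of_real pi * \<i> * of_real (x * y))" for x
  proof -
    have "s * (0 + c * x) = 2 * pi * (x * y)" using sc by (simp add: mult.assoc[symmetric])
    then have "\<i> * complex_of_real (s * (0 + c * x)) = 2 * of_real pi * \<i> * of_real (x * y)"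
      by (simp only: of_real_mult of_real_numeral mult_ac)
    then have arg: "\<i> * (complex_of_real s * (complex_of_real c * complex_of_real x)) = 2 * of_real pi * \<i> * (of_real x * of_real y)"
      by simp
    moreover have "(c * x)\<^sup>2 / 2 = pi * x\<^sup>2 / t" using t by (simp add: c_def power_mult_distrib)
    ultimately show ?thesis
      by (simp add: std_normal_density_def scaleR_conv_of_real arg)
  qed
  moreover have "sqrt (2 * pi) *\<^sub>R (complex_of_real (exp (- (s^2) / 2)) /\<^sub>R \<bar>c\<bar>) = complex_of_real (sqrt t * exp (- (pi * t * y\<^sup>2)))"
  proof -
    have "sqrt (2 * pi) / c = sqrt t" using t by (simp add: c_def real_sqrt_divide)
    moreover have "s\<^sup>2 / 2 = pi * t * y\<^sup>2" using t by (simp add: s_def power_mult_distrib)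
    ultimately show ?thesis using c by (simp add: scaleR_conv_of_real field_simps flip: of_real_mult of_real_divide)
  qed
  ultimately show ?thesis by simp
qed

lemma has_bochner_integral_lborel_prod:
  fixes f :: "'a::euclidean_space \<Rightarrow> real \<Rightarrow> complex"
  assumes f: "\<And>b. b \<in> Basis \<Longrightarrow> has_bochner_integral lborel (f b) (I b)"
  shows "has_bochner_integral lborel (\<lambda>x. \<Prod>b\<in>Basis. f b (x \<bullet> b)) (\<Prod>b\<in>Basis. I b)"
proof -
  interpret P: product_sigma_finite "\<lambda>b::'a. lborel :: real measure"
    by standard
  have int: "\<And>b. b \<in> Basis \<Longrightarrow> integrable lborel (f b)" using f by (auto simp: has_bochner_integral_iff)
  have I: "integrable (\<Pi>\<^sub>M b\<in>(Basis::'a set). lborel) (\<lambda>x. (\<Prod>b\<in>Basis. f b (x b)))"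
    using int by (intro P.product_integrable_prod) auto
  have E: "(\<integral>x. (\<Prod>b\<in>Basis. f b (x b)) \<partial>(\<Pi>\<^sub>M b\<in>(Basis::'a set). lborel)) = (\<Prod>b\<in>Basis. I b)"
    using int f by (subst P.product_integral_prod) (auto simp: has_bochner_integral_iff)
  have [measurable]: "\<And>b. b \<in> Basis \<Longrightarrow> f b \<in> borel_measurable borel"
    using int by (auto dest: borel_measurable_integrable)
  have *: "(\<lambda>x. \<Prod>b\<in>Basis. f b ((\<Sum>i\<in>Basis. x i *\<^sub>R i) \<bullet> b)) = (\<lambda>x. (\<Prod>b\<in>(Basis::'a set). f b (x b)))"
    by (auto intro!: ext prod.cong)
  show ?thesis
    unfolding has_bochner_integral_iff
    by (subst (1 2) lborel_eq) (simp add: integrable_distr_eq integral_distr * I E)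
qed

text \<open>
  Gaussian and character both factor over the coordinates, which reduces the claim to dimension one.
  Mass 1 is the case \<open>y = 0\<close>.
\<close>
lemma heat_fourier:
  fixes y :: "'a::euclidean_space"
  assumes t: "t > 0"
  shows "has_bochner_integral lborel (\<lambda>x::'a. complex_of_real (heat t x) * exp (2 * of_real pi * \<i> * of_real (x \<bullet> y)))
     (complex_of_real (exp (- (pi * t * (norm y)\<^sup>2))))"
proof -
  have nrm: "(norm x)\<^sup>2 = (\<Sum>b\<in>Basis. (x \<bullet> b)\<^sup>2)" for x :: 'a
    unfolding power2_norm_eq_inner by (subst euclidean_inner) (simp add: power2_eq_square)
  have s: "sqrt t ^ DIM('a) = t powr (real DIM('a) / 2)"
    using t by (simp add: powr_half_sqrt[symmetric] powr_realpow[symmetric] powr_powr)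
  have "has_bochner_integral lborel (\<lambda>x::'a. \<Prod>b\<in>Basis. complex_of_real (exp (- (pi * (x \<bullet> b)\<^sup>2 / t)) ) * exp (2 * of_real pi * \<i> * of_real ((x \<bullet> b) * (y \<bullet> b))))
    (\<Prod>b\<in>(Basis::'a set). (complex_of_real (sqrt t * exp (- (pi * t * (y \<bullet> b)\<^sup>2)))))"
    by (intro has_bochner_integral_lborel_prod[where f="\<lambda>b u. complex_of_real (exp (- (pi * u\<^sup>2 / t)) ) * exp (2 * of_real pi * \<i> * of_real (u * (y \<bullet> b)))"] gaussian_fourier_real t)
  then have "has_bochner_integral lborel (\<lambda>x::'a. (1 / t powr (real DIM('a) / 2)) *\<^sub>R (\<Prod>b\<in>Basis. complex_of_real (exp (- (pi * (x \<bullet> b)\<^sup>2 / t)) ) * exp (2 * of_real pi * \<i> * of_real ((x \<bullet> b) * (y \<bullet> b)))))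
    ((1 / t powr (real DIM('a) / 2)) *\<^sub>R (\<Prod>b\<in>(Basis::'a set). (complex_of_real (sqrt t * exp (- (pi * t * (y \<bullet> b)\<^sup>2))))))"
    by (rule has_bochner_integral_scaleR_right)
  moreover have "(1 / t powr (real DIM('a) / 2)) *\<^sub>R (\<Prod>b\<in>(Basis::'a set). (complex_of_real (sqrt t * exp (- (pi * t * (y \<bullet> b)\<^sup>2))))) = complex_of_real (exp (- (pi * t * (norm y)\<^sup>2)))"
  proof -
    have "(\<Prod>b\<in>(Basis::'a set). sqrt t * exp (- (pi * t * (y \<bullet> b)\<^sup>2))) = t powr (real DIM('a) / 2) * exp (- (pi * t * (norm y)\<^sup>2))"
      by (simp add: prod.distrib exp_sum[symmetric] s nrm sum_distrib_left sum_negf)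
    then show ?thesis
      using t by (simp only: of_real_prod[symmetric] scaleR_conv_of_real of_real_mult[symmetric]) simp
  qed
  moreover have "(1 / t powr (real DIM('a) / 2)) *\<^sub>R (\<Prod>b\<in>Basis. complex_of_real (exp (- (pi * (x \<bullet> b)\<^sup>2 / t)) ) * exp (2 * of_real pi * \<i> * of_real ((x \<bullet> b) * (y \<bullet> b))))
    = complex_of_real (heat t x) * exp (2 * of_real pi * \<i> * of_real (x \<bullet> y))" for x :: 'a
  proof -
    have "(\<Prod>b\<in>(Basis::'a set). exp (- (pi * (x \<bullet> b)\<^sup>2 / t))) = exp (- (pi * (norm x)\<^sup>2 / t))"
      by (simp add: exp_sum[symmetric] nrm sum_distrib_left sum_negf sum_divide_distrib)
    moreover have "(\<Prod>b\<in>(Basis::'a set). exp (2 * of_real pi * \<i> * complex_of_real ((x \<bullet> b) * (y \<bullet> b)))) = exp (2 * of_real pi * \<i> * of_real (x \<bullet> y))"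
      by (simp add: exp_sum[symmetric] euclidean_inner[of x y] sum_distrib_left)
    ultimately show ?thesis
      by (simp add: prod.distrib heat_def scaleR_conv_of_real flip: of_real_prod)
  qed
  ultimately show ?thesis by simp
qed

lemma nn_integral_heat:
  assumes t: "t > 0"
  shows "(\<integral>\<^sup>+x. ennreal (heat t (x::'a::euclidean_space)) \<partial>lborel) = 1"
proof -
  have "has_bochner_integral lborel (\<lambda>x::'a. complex_of_real (heat t x)) 1"
    using heat_fourier[OF t, of 0] by simp
  then have "has_bochner_integral lborel (\<lambda>x::'a. heat t x) 1"
    using has_bochner_integral_bounded_linear[OF bounded_linear_Re, of lborel "\<lambda>x::'a. complex_of_real (heat t x)" 1]
    by simp
  then show ?thesis
    by (simp add: has_bochner_integral_iff nn_integral_eq_integral)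
qed

lemma integrable_heat: "t > 0 \<Longrightarrow> integrable lborel (heat t :: 'a::euclidean_space \<Rightarrow> real)"
  using nn_integral_heat[of t, where 'a='a] by (intro integrableI_bounded) (auto simp: heat_def)

section \<open>Convolution of Riesz kernels\<close>

text \<open>
  Completing the square in \<open>y\<close>: with $k = \frac{t}{s+t}$,
  $\frac{|x-y|^2}{s} + \frac{|y|^2}{t} = \frac{|x|^2}{s+t} + \frac{s+t}{st}\,|y - kx|^2$.
\<close>
lemma heat_mult_heat:
  fixes x y :: "'a::euclidean_space"
  assumes s: "s > 0" and t: "t > 0"
  shows "heat s (x - y) * heat t y = heat (s + t) x * heat (s * t / (s + t)) (y - (t / (s + t)) *\<^sub>R x)"
proof -
  define k where "k = t / (s + t)"
  define X Y Z where "X = x \<bullet> x" and "Y = y \<bullet> y" and "Z = x \<bullet> y"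
  have 1: "(norm (x - y))\<^sup>2 = X - 2 * Z + Y"
    unfolding power2_norm_eq_inner by (simp add: inner_diff_left inner_diff_right inner_commute X_def Y_def Z_def)
  have 2: "(norm (y - k *\<^sub>R x))\<^sup>2 = Y - 2 * k * Z + k\<^sup>2 * X"
    unfolding power2_norm_eq_inner by (simp add: inner_diff_left inner_diff_right inner_commute X_def Y_def Z_def power2_eq_square)
  have 3: "(norm x)\<^sup>2 = X" "(norm y)\<^sup>2 = Y" by (simp_all add: power2_norm_eq_inner X_def Y_def)
  have "(X - 2 * Z + Y) / s + Y / t = X / (s + t) + (Y - 2 * k * Z + k\<^sup>2 * X) / (s * t / (s + t))"
  proof -
    have nz: "s \<noteq> 0" "t \<noteq> 0" "s + t \<noteq> 0" using s t by auto
    have "(Y - 2 * k * Z + k\<^sup>2 * X) / (s * t / (s + t)) = Y * (s + t) / (s * t) - 2 * Z / s + t * X / (s * (s + t))"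
    proof -
      have "k * (s + t) = t" using nz by (simp add: k_def)
      moreover have "(Y - 2 * k * Z + k\<^sup>2 * X) * (s + t) = Y * (s + t) - 2 * (k * (s + t)) * Z + k * (k * (s + t)) * X"
        by (simp add: power2_eq_square algebra_simps)
      ultimately have "(Y - 2 * k * Z + k\<^sup>2 * X) * (s + t) = Y * (s + t) - 2 * t * Z + k * t * X"
        by simp
      then show ?thesis using nz by (simp add: k_def diff_divide_distrib add_divide_distrib)
    qed
    moreover have "Y * (s + t) / (s * t) = Y / s + Y / t" using nz by (simp add: field_simps)
    moreover have "t * X / (s * (s + t)) + X / (s + t) = X / s" using nz by (simp add: divide_simps) (simp add: algebra_simps)
    ultimately show ?thesis by (simp add: diff_divide_distrib add_divide_distrib)
  qed
  then have "pi * ((X - 2 * Z + Y) / s + Y / t) = pi * (X / (s + t) + (Y - 2 * k * Z + k\<^sup>2 * X) / (s * t / (s + t)))"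
    by simp
  then have e: "- (pi * (X - 2 * Z + Y) / s) + - (pi * Y / t) = - (pi * X / (s + t)) + - (pi * (Y - 2 * k * Z + k\<^sup>2 * X) / (s * t / (s + t)))"
    by (simp only: distrib_left times_divide_eq_right minus_add_distrib[symmetric])
  have "exp (- (pi * (X - 2 * Z + Y) / s)) * exp (- (pi * Y / t)) = exp (- (pi * X / (s + t))) * exp (- (pi * (Y - 2 * k * Z + k\<^sup>2 * X) / (s * t / (s + t))))"
    unfolding exp_add[symmetric] e ..
  moreover have "s powr (DIM('a)/2) * t powr (DIM('a)/2) = (s + t) powr (DIM('a)/2) * (s * t / (s + t)) powr (DIM('a)/2)"
    using s t by (simp flip: powr_mult)
  ultimately show ?thesis
    unfolding heat_def k_def[symmetric] 1 2 3 times_divide_times_eq by (simp only:)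
qed

lemma nn_integral_lborel_shift:
  fixes f :: "'a::euclidean_space \<Rightarrow> ennreal"
  assumes [measurable]: "f \<in> borel_measurable borel"
  shows "(\<integral>\<^sup>+x. f (x + c) \<partial>lborel) = (\<integral>\<^sup>+x. f x \<partial>lborel)"
proof -
  have "(\<integral>\<^sup>+x. f x \<partial>lborel) = (\<integral>\<^sup>+x. f x \<partial>distr lborel borel ((+) c))" by (simp add: lborel_distr_plus)
  also have "\<dots> = (\<integral>\<^sup>+x. f (c + x) \<partial>lborel)" by (simp add: nn_integral_distr)
  finally show ?thesis by (simp add: add.commute)
qed

lemma heat_semigroup:
  fixes x :: "'a::euclidean_space"
  assumes s: "s > 0" and t: "t > 0"
  shows "(\<integral>\<^sup>+y. ennreal (heat s (x - y) * heat t y) \<partial>lborel) = ennreal (heat (s + t) x)"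
proof -
  have "(\<integral>\<^sup>+y. ennreal (heat s (x - y) * heat t y) \<partial>lborel)
     = ennreal (heat (s + t) x) * (\<integral>\<^sup>+y. ennreal (heat (s * t / (s + t)) (y + - ((t / (s + t)) *\<^sub>R x))) \<partial>lborel)"
    by (simp add: heat_mult_heat[OF s t] ennreal_mult' nn_integral_cmult)
  also have "(\<integral>\<^sup>+y. ennreal (heat (s * t / (s + t)) (y + - ((t / (s + t)) *\<^sub>R x))) \<partial>lborel) = 1"
    using s t by (subst nn_integral_lborel_shift) (auto simp: nn_integral_heat)
  finally show ?thesis by simp
qed

text \<open>
  Substitute \<open>u = s + t\<close> for \<open>t\<close> and integrate over \<open>s\<close> first: the integral of
  $s^{p-1}(u-s)^{q-1}$ over $0 < s < u$ is the Beta integral scaled by \<open>u\<close>.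
\<close>
lemma nn_integral_beta_convolution:
  fixes F :: "real \<Rightarrow> ennreal"
  assumes [measurable]: "F \<in> borel_measurable borel" and p: "p > 0" and q: "q > 0"
  shows "(\<integral>\<^sup>+s. (\<integral>\<^sup>+t. ennreal (s powr (p - 1) * t powr (q - 1)) * F (s + t) * indicator {0<..} s * indicator {0<..} t \<partial>lborel) \<partial>lborel)
    = ennreal (Beta p q) * (\<integral>\<^sup>+r\<in>{0<..}. ennreal (r powr (p + q - 1)) * F r \<partial>lborel)"
proof -
  let ?g = "\<lambda>s u. ennreal (s powr (p - 1) * (u - s) powr (q - 1)) * F u * indicator {0<..} s * indicator {0<..} (u - s)"
  have "(\<integral>\<^sup>+s. (\<integral>\<^sup>+t. ennreal (s powr (p - 1) * t powr (q - 1)) * F (s + t) * indicator {0<..} s * indicator {0<..} t \<partial>lborel) \<partial>lborel)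
     = (\<integral>\<^sup>+s. (\<integral>\<^sup>+u. ?g s u \<partial>lborel) \<partial>lborel)"
  proof (rule nn_integral_cong)
    fix s :: real
    show "(\<integral>\<^sup>+t. ennreal (s powr (p - 1) * t powr (q - 1)) * F (s + t) * indicator {0<..} s * indicator {0<..} t \<partial>lborel) = (\<integral>\<^sup>+u. ?g s u \<partial>lborel)"
      by (subst nn_integral_real_affine[where c=1 and t="- s"]) auto
  qed
  also have "\<dots> = (\<integral>\<^sup>+u. (\<integral>\<^sup>+s. ?g s u \<partial>lborel) \<partial>lborel)"
    by (rule lborel_pair.Fubini') measurable
  also have "\<dots> = (\<integral>\<^sup>+u. ennreal (Beta p q) * (ennreal (u powr (p + q - 1)) * F u * indicator {0<..} u) \<partial>lborel)"
  proof (intro nn_integral_cong)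
    fix u :: real
    show "(\<integral>\<^sup>+s. ?g s u \<partial>lborel) = ennreal (Beta p q) * (ennreal (u powr (p + q - 1)) * F u * indicator {0<..} u)"
    proof (cases "u > 0")
      case False
      then have "?g s u = 0" for s by (auto simp: indicator_def)
      then have "(\<integral>\<^sup>+s. ?g s u \<partial>lborel) = (\<integral>\<^sup>+s. 0 \<partial>(lborel :: real measure))"
        by (intro nn_integral_cong)
      then show ?thesis using False by simp
    next
      case u: True
      have B: "(\<integral>\<^sup>+v. ennreal (v powr (p - 1) * (1 - v) powr (q - 1)) * indicator {0..1} v \<partial>lborel) = ennreal (Beta p q)"
        by (rule nn_integral_has_integral_lebesgue'[OF _ has_integral_Beta_real[OF p q]]) auto
      have "(\<integral>\<^sup>+s. ?g s u \<partial>lborel) = ennreal u * (\<integral>\<^sup>+v. ?g (u * v) u \<partial>lborel)"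
        using u by (subst nn_integral_real_affine[where c=u and t=0]) auto
      also have "(\<integral>\<^sup>+v. ?g (u * v) u \<partial>lborel) = (\<integral>\<^sup>+v. ennreal (u powr (p + q - 2)) * F u * (ennreal (v powr (p - 1) * (1 - v) powr (q - 1)) * indicator {0..1} v) \<partial>lborel)"
      proof (intro nn_integral_cong)
        fix v :: real
        consider "v \<le> 0" | "v \<ge> 1" | "0 < v" "v < 1" by linarith
        then show "?g (u * v) u = ennreal (u powr (p + q - 2)) * F u * (ennreal (v powr (p - 1) * (1 - v) powr (q - 1)) * indicator {0..1} v)"
        proof cases
          case 1
          then show ?thesis using u by (cases "v = 0") (auto simp: indicator_def zero_less_mult_iff)
        next
          case 2
          then show ?thesis using u by (cases "v = 1") (auto simp: indicator_def)
        next
          case 3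
          have "(u * v) powr (p - 1) * (u - u * v) powr (q - 1) = u powr (p + q - 2) * (v powr (p - 1) * (1 - v) powr (q - 1))"
          proof -
            have "(u - u * v) = u * (1 - v)" by (simp add: algebra_simps)
            moreover have "u powr (p + q - 2) = u powr (p - 1) * u powr (q - 1)" by (simp add: powr_add[symmetric])
            ultimately show ?thesis using u 3 by (simp add: powr_mult)
          qed
          then show ?thesis using u 3 by (simp add: ennreal_mult' mult_ac)
        qed
      qed
      also have "\<dots> = ennreal (u powr (p + q - 2)) * F u * ennreal (Beta p q)"
        by (subst nn_integral_cmult) (auto simp: B)
      also have "ennreal u * \<dots> = ennreal (u * u powr (p + q - 2)) * F u * ennreal (Beta p q)"
        using u by (simp add: ennreal_mult' mult_ac)
      also have "u * u powr (p + q - 2) = u powr (p + q - 1)"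
        using u powr_add[of u 1 "p + q - 2"] by simp
      finally show ?thesis using u by (simp add: mult_ac)
    qed
  qed
  also have "\<dots> = ennreal (Beta p q) * (\<integral>\<^sup>+r\<in>{0<..}. ennreal (r powr (p + q - 1)) * F r \<partial>lborel)"
    by (rule nn_integral_cmult) auto
  finally show ?thesis .
qed

text \<open>
  Convolving two superpositions of heat kernels only adds the times, by the semigroup law. What remains
  is a convolution of powers in the time variables.
\<close>
lemma heat_superposition_convolution:
  fixes x :: "'a::euclidean_space" and a b :: real
  assumes a: "0 < a" and b: "0 < b"
  shows "(\<integral>\<^sup>+y. (\<integral>\<^sup>+s\<in>{0<..}. ennreal (s powr (a/2 - 1) * heat s (x - y)) \<partial>lborel)
        * (\<integral>\<^sup>+t\<in>{0<..}. ennreal (t powr (b/2 - 1) * heat t y) \<partial>lborel) \<partial>lborel)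
    = ennreal (Beta (a/2) (b/2)) * (\<integral>\<^sup>+t\<in>{0<..}. ennreal (t powr ((a + b)/2 - 1) * heat t x) \<partial>lborel)"
proof -
  let ?w = "\<lambda>s t. ennreal (s powr (a/2 - 1) * t powr (b/2 - 1)) :: ennreal"
  let ?G = "\<lambda>s t y. ?w s t * ennreal (heat s (x - y) * heat t y) * indicator {0<..} s * indicator {0<..} t"
  have "(\<integral>\<^sup>+y. (\<integral>\<^sup>+s\<in>{0<..}. ennreal (s powr (a/2 - 1) * heat s (x - y)) \<partial>lborel)
        * (\<integral>\<^sup>+t\<in>{0<..}. ennreal (t powr (b/2 - 1) * heat t y) \<partial>lborel) \<partial>lborel)
     = (\<integral>\<^sup>+y. (\<integral>\<^sup>+s. (\<integral>\<^sup>+t. ?G s t y \<partial>lborel) \<partial>lborel) \<partial>lborel)"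
  proof (rule nn_integral_cong)
    fix y :: 'a
    have "(\<integral>\<^sup>+s. (\<integral>\<^sup>+t. ?G s t y \<partial>lborel) \<partial>lborel)
       = (\<integral>\<^sup>+s. ennreal (s powr (a/2 - 1) * heat s (x - y)) * indicator {0<..} s * (\<integral>\<^sup>+t\<in>{0<..}. ennreal (t powr (b/2 - 1) * heat t y) \<partial>lborel) \<partial>lborel)"
    proof (rule nn_integral_cong)
      fix s :: real
      have "(\<integral>\<^sup>+t. ?G s t y \<partial>lborel) = (\<integral>\<^sup>+t. ennreal (s powr (a/2 - 1) * heat s (x - y)) * indicator {0<..} s * (ennreal (t powr (b/2 - 1) * heat t y) * indicator {0<..} t) \<partial>lborel)"
        by (intro nn_integral_cong) (simp add: ennreal_mult' mult_ac)
      then show "(\<integral>\<^sup>+t. ?G s t y \<partial>lborel) = ennreal (s powr (a/2 - 1) * heat s (x - y)) * indicator {0<..} s * (\<integral>\<^sup>+t\<in>{0<..}. ennreal (t powr (b/2 - 1) * heat t y) \<partial>lborel)"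
        by (simp add: nn_integral_cmult)
    qed
    then show "(\<integral>\<^sup>+s\<in>{0<..}. ennreal (s powr (a/2 - 1) * heat s (x - y)) \<partial>lborel)
        * (\<integral>\<^sup>+t\<in>{0<..}. ennreal (t powr (b/2 - 1) * heat t y) \<partial>lborel) = (\<integral>\<^sup>+s. (\<integral>\<^sup>+t. ?G s t y \<partial>lborel) \<partial>lborel)"
      by (simp add: nn_integral_multc)
  qed
  also have "\<dots> = (\<integral>\<^sup>+s. (\<integral>\<^sup>+y. (\<integral>\<^sup>+t. ?G s t y \<partial>lborel) \<partial>lborel) \<partial>lborel)"
    by (rule lborel_pair.Fubini') measurable
  also have "\<dots> = (\<integral>\<^sup>+s. (\<integral>\<^sup>+t. (\<integral>\<^sup>+y. ?G s t y \<partial>lborel) \<partial>lborel) \<partial>lborel)"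
    by (rule nn_integral_cong, rule lborel_pair.Fubini') measurable
  also have "\<dots> = (\<integral>\<^sup>+s. (\<integral>\<^sup>+t. ?w s t * ennreal (heat (s + t) x) * indicator {0<..} s * indicator {0<..} t \<partial>lborel) \<partial>lborel)"
  proof (rule nn_integral_cong, rule nn_integral_cong)
    fix s t :: real
    show "(\<integral>\<^sup>+y. ?G s t y \<partial>lborel) = ?w s t * ennreal (heat (s + t) x) * indicator {0<..} s * indicator {0<..} t"
    proof (cases "s > 0 \<and> t > 0")
      case True
      then show ?thesis by (simp add: nn_integral_cmult heat_semigroup)
    next
      case False
      then have "?G s t y = 0" for y by (auto simp: indicator_def)
      then have "(\<integral>\<^sup>+y. ?G s t y \<partial>lborel) = (\<integral>\<^sup>+y. 0 \<partial>(lborel :: 'a measure))"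
        by (intro nn_integral_cong)
      then show ?thesis using False by auto
    qed
  qed
  also have "\<dots> = ennreal (Beta (a/2) (b/2)) * (\<integral>\<^sup>+t\<in>{0<..}. ennreal (t powr (a/2 + b/2 - 1)) * ennreal (heat t x) \<partial>lborel)"
    using a b by (intro nn_integral_beta_convolution) auto
  finally show ?thesis by (simp add: ennreal_mult' add_divide_distrib)
qed

text \<open>
  The ratio of the superposition of heat kernels with weight $t^{a/2-1}$ to $|x|^{a-n}$.
\<close>
definition riesz_const :: "real \<Rightarrow> real \<Rightarrow> real" where
  "riesz_const n a = Gamma ((n - a) / 2) / pi powr ((n - a) / 2)"

lemma riesz_const_pos: "a < n \<Longrightarrow> riesz_const n a > 0"
  by (simp add: riesz_const_def Gamma_real_pos)

text \<open>
  At fixed \<open>x\<close> the heat kernel is a power of \<open>t\<close> times $e^{-c/t}$ with $c = \pi|x|^2$, so this is the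
  inverted Gamma integral.
\<close>
lemma riesz_kernel_subordination:
  fixes x :: "'a::euclidean_space" and a :: real
  assumes a: "a < DIM('a)" and x: "x \<noteq> 0"
  shows "(\<integral>\<^sup>+t\<in>{0<..}. ennreal (t powr (a/2 - 1) * heat t x) \<partial>lborel)
    = ennreal (riesz_const DIM('a) a * norm x powr (a - DIM('a)))"
proof -
  define q where "q = (DIM('a) - a) / 2"
  have q: "q > 0" using a by (simp add: q_def)
  have "(\<integral>\<^sup>+t\<in>{0<..}. ennreal (t powr (a/2 - 1) * heat t x) \<partial>lborel)
     = (\<integral>\<^sup>+t\<in>{0<..}. ennreal (t powr (- q - 1) * exp (- ((pi * (norm x)\<^sup>2) / t))) \<partial>lborel)"
  proof (intro nn_integral_cong)
    fix t :: real
    have "t powr (a/2 - 1) / t powr (real DIM('a) / 2) = t powr (- q - 1)"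
    proof -
      have "a/2 - 1 - real DIM('a) / 2 = - q - 1" by (simp add: q_def field_simps)
      then show ?thesis by (simp only: powr_diff[symmetric])
    qed
    then have "t powr (a/2 - 1) * heat t x = t powr (- q - 1) * exp (- ((pi * (norm x)\<^sup>2) / t))"
      unfolding heat_def by (metis (no_types) mult.commute times_divide_eq_right)
    then show "ennreal (t powr (a/2 - 1) * heat t x) * indicator {0<..} t
      = ennreal (t powr (- q - 1) * exp (- ((pi * (norm x)\<^sup>2) / t))) * indicator {0<..} t"
      by simp
  qed
  also have "\<dots> = ennreal (Gamma q / (pi * (norm x)\<^sup>2) powr q)"
    using q x by (intro nn_integral_power_exp_inverse) auto
  also have "(pi * (norm x)\<^sup>2) powr q = pi powr q * norm x powr (DIM('a) - a)"
  proof -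
    have "((norm x)\<^sup>2) powr q = norm x powr (2 * q)" using x by (simp add: powr_powr flip: powr_numeral)
    also have "2 * q = DIM('a) - a" by (simp add: q_def)
    finally show ?thesis by (simp add: powr_mult)
  qed
  also have "norm x powr (DIM('a) - a) = 1 / norm x powr (a - DIM('a))"
    by (simp add: powr_minus_divide[symmetric])
  finally show ?thesis using x by (simp add: q_def riesz_const_def field_simps)
qed

text \<open>
  The constant in $|x|^{a-n} * |x|^{b-n} = C\,|x|^{a+b-n}$. In terms of $\gamma = n-a-b$ it is symmetric
  under permutations of $a, b, \gamma$, which is why the two integrals in Schur's test agree.
\<close>
definition riesz_conv_const :: "real \<Rightarrow> real \<Rightarrow> real \<Rightarrow> real" where
  "riesz_conv_const n a b = pi powr (n/2) * (Gamma (a/2) * Gamma (b/2) * Gamma ((n - a - b)/2))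
     / (Gamma ((n - a)/2) * Gamma ((n - b)/2) * Gamma ((a + b)/2))"

lemma riesz_conv_const_pos: "0 < a \<Longrightarrow> 0 < b \<Longrightarrow> a + b < n \<Longrightarrow> riesz_conv_const n a b > 0"
  unfolding riesz_conv_const_def by (intro divide_pos_pos mult_pos_pos Gamma_real_pos) auto

lemma riesz_conv_const_eq:
  assumes "0 < a" "0 < b" "a + b < n"
  shows "Beta (a/2) (b/2) * riesz_const n (a + b) / (riesz_const n a * riesz_const n b) = riesz_conv_const n a b"
proof -
  \<comment> \<open>The powers of $\pi$ in the three factors \<open>riesz_const\<close> collapse to $\pi^{n/2}$.\<close>
  have "pi powr ((n - a)/2) * pi powr ((n - b)/2) = pi powr (n/2) * pi powr ((n - (a + b))/2)"
    by (simp add: powr_add[symmetric] add_divide_distrib[symmetric] algebra_simps)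
  then have *: "pi powr ((n - a)/2) * pi powr ((n - b)/2) / pi powr ((n - (a + b))/2) = pi powr (n/2)"
    by simp
  have "Beta (a/2) (b/2) * riesz_const n (a + b) / (riesz_const n a * riesz_const n b)
    = (pi powr ((n - a)/2) * pi powr ((n - b)/2) / pi powr ((n - (a + b))/2))
      * (Gamma (a/2) * Gamma (b/2) * Gamma ((n - (a + b))/2)) / (Gamma ((n - a)/2) * Gamma ((n - b)/2) * Gamma ((a + b)/2))"
    by (simp add: Beta_def riesz_const_def add_divide_distrib mult_ac)
  then show ?thesis unfolding * by (simp add: riesz_conv_const_def diff_diff_eq)
qed

text \<open>
  Express both kernels through the heat kernel and convolve the superpositions.
\<close>
lemma riesz_kernel_convolution:
  fixes x :: "'a::euclidean_space" and a b :: real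
  defines "n \<equiv> real DIM('a)"
  assumes a: "0 < a" and b: "0 < b" and ab: "a + b < n" and x: "x \<noteq> 0"
  shows "(\<integral>\<^sup>+y. ennreal (norm (x - y) powr (a - n) * norm y powr (b - n)) \<partial>lborel)
    = ennreal (riesz_conv_const n a b * norm x powr (a + b - n))"
    (is "?I = _")
proof -
  define c where "c = riesz_const n a * riesz_const n b"
  have c: "c > 0" using a b ab by (simp add: c_def riesz_const_pos)
  have "ennreal c * ?I = (\<integral>\<^sup>+y. ennreal c * ennreal (norm (x - y) powr (a - n) * norm y powr (b - n)) \<partial>lborel)"
    by (simp add: nn_integral_cmult)
  also have "\<dots> = (\<integral>\<^sup>+y. (\<integral>\<^sup>+s\<in>{0<..}. ennreal (s powr (a/2 - 1) * heat s (x - y)) \<partial>lborel)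
        * (\<integral>\<^sup>+t\<in>{0<..}. ennreal (t powr (b/2 - 1) * heat t y) \<partial>lborel) \<partial>lborel)"
  proof (intro nn_integral_cong_AE)
    show "AE y in lborel. ennreal c * ennreal (norm (x - y) powr (a - n) * norm y powr (b - n)) =
       (\<integral>\<^sup>+s\<in>{0<..}. ennreal (s powr (a/2 - 1) * heat s (x - y)) \<partial>lborel)
        * (\<integral>\<^sup>+t\<in>{0<..}. ennreal (t powr (b/2 - 1) * heat t y) \<partial>lborel)"
      using AE_lborel_singleton[of 0] AE_lborel_singleton[of x]
    proof eventually_elim
      case (elim y)
      have "riesz_const n a > 0" using a b ab by (intro riesz_const_pos) auto
      moreover have "(\<integral>\<^sup>+s\<in>{0<..}. ennreal (s powr (a/2 - 1) * heat s (x - y)) \<partial>lborel) = ennreal (riesz_const n a * norm (x - y) powr (a - n))"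
        using elim a b ab unfolding n_def by (intro riesz_kernel_subordination) auto
      moreover have "(\<integral>\<^sup>+t\<in>{0<..}. ennreal (t powr (b/2 - 1) * heat t y) \<partial>lborel) = ennreal (riesz_const n b * norm y powr (b - n))"
        using elim a b ab unfolding n_def by (intro riesz_kernel_subordination) auto
      moreover have "ennreal c * ennreal (norm (x - y) powr (a - n) * norm y powr (b - n))
          = ennreal ((riesz_const n a * norm (x - y) powr (a - n)) * (riesz_const n b * norm y powr (b - n)))"
        using c by (simp add: c_def ennreal_mult'[symmetric] mult_ac)
      moreover have "\<dots> = ennreal (riesz_const n a * norm (x - y) powr (a - n)) * ennreal (riesz_const n b * norm y powr (b - n))"
        using \<open>riesz_const n a > 0\<close> by (intro ennreal_mult') simp
      ultimately show ?case by simp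
    qed
  qed
  also have "\<dots> = ennreal (Beta (a/2) (b/2)) * ennreal (riesz_const n (a + b) * norm x powr (a + b - n))"
    using ab x by (simp add: heat_superposition_convolution[OF a b] riesz_kernel_subordination n_def)
  also have "\<dots> = ennreal (Beta (a/2) (b/2) * riesz_const n (a + b) * norm x powr (a + b - n))"
    using a b ab riesz_const_pos[of "a + b" n] by (subst ennreal_mult''[symmetric]) (auto simp: mult_ac less_imp_le)
  finally have *: "ennreal c * ?I = ennreal (Beta (a/2) (b/2) * riesz_const n (a + b) * norm x powr (a + b - n))" .
  have "?I = ennreal (1 / c) * (ennreal c * ?I)"
    using c by (simp add: mult.assoc[symmetric] ennreal_mult'[symmetric])
  also have "\<dots> = ennreal (Beta (a/2) (b/2) * riesz_const n (a + b) / c * norm x powr (a + b - n))"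
    using c unfolding * by (simp add: ennreal_mult'[symmetric])
  finally show ?thesis using riesz_conv_const_eq[OF a b ab] by (simp add: c_def)
qed

section \<open>Fourier transforms of Schwartz functions\<close>

text \<open>
  The character $r \mapsto e^{2\pi i r}$, so that its multiplicative law is available by name.
\<close>
definition wave :: "real \<Rightarrow> complex" where
  "wave r = exp (2 * of_real pi * \<i> * of_real r)"

lemma norm_wave[simp]: "norm (wave r) = 1"
  by (simp add: wave_def norm_exp_eq_Re)

lemma wave_add: "wave (r + s) = wave r * wave s"
  by (simp add: wave_def exp_add[symmetric] distrib_left)

lemma wave_0[simp]: "wave 0 = 1"
  by (simp add: wave_def)

lemma measurable_wave[measurable]: "wave \<in> borel_measurable borel"
  unfolding wave_def by measurable

lemma fourier_wave: "fourier f y = (LINT x|lborel. wave (x \<bullet> y) * f x)"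
  by (simp add: fourier_def wave_def)

lemma inverse_fourier_wave: "inverse_fourier h x = (LINT y|lborel. wave (- (x \<bullet> y)) * h y)"
  by (simp add: inverse_fourier_def wave_def)

lemma measurable_fourier[measurable]:
  assumes [measurable]: "f \<in> borel_measurable borel"
  shows "fourier f \<in> borel_measurable borel"
  unfolding fourier_wave[abs_def] by measurable

lemma measurable_inverse_fourier[measurable]:
  assumes [measurable]: "f \<in> borel_measurable borel"
  shows "inverse_fourier f \<in> borel_measurable borel"
  unfolding inverse_fourier_wave[abs_def] by measurable

lemma norm_fourier_le: "norm (fourier f y) \<le> (LINT x|lborel. norm (f x))"
  unfolding fourier_wave by (rule order.trans[OF integral_norm_bound]) (simp add: norm_mult)

lemma integrable_wave_mult:
  fixes f :: "'a::euclidean_space \<Rightarrow> complex"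
  assumes "integrable lborel f" and [measurable]: "l \<in> borel_measurable borel"
  shows "integrable lborel (\<lambda>x. wave (l x) * f x)"
proof -
  have [measurable]: "f \<in> borel_measurable borel" using borel_measurable_integrable[OF assms(1)] by simp
  show ?thesis
    by (rule Bochner_Integration.integrable_bound[OF assms(1)]) (auto simp: norm_mult)
qed

lemma lborel_integrable_shift:
  fixes f :: "'a::euclidean_space \<Rightarrow> 'b::{banach, second_countable_topology}"
  assumes "integrable lborel f"
  shows "integrable lborel (\<lambda>x. f (x + c))"
proof -
  have "integrable (distr lborel borel ((+) c)) f" using assms by (simp add: lborel_distr_plus)
  then show ?thesis by (subst (asm) integrable_distr_eq) (use assms in \<open>auto simp: add.commute\<close>)
qed

lemma lborel_integral_shift:
  fixes f :: "'a::euclidean_space \<Rightarrow> 'b::{banach, second_countable_topology}"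
  assumes [measurable]: "f \<in> borel_measurable borel"
  shows "(LINT x|lborel. f (x + c)) = (LINT x|lborel. f x)"
proof -
  have "(LINT x|lborel. f x) = (LINT x|distr lborel borel ((+) c). f x)" by (simp add: lborel_distr_plus)
  also have "\<dots> = (LINT x|lborel. f (c + x))" by (subst integral_distr) auto
  finally show ?thesis by (simp add: add.commute)
qed

text \<open>
  By the Gamma integral, $(1+|x|^2)^{-n}$ is a superposition of the Gaussians $e^{-t|x|^2}$ with weight
  $t^{n-1}e^{-t}$, up to a constant. The Gaussians have integral $(\pi/t)^{n/2}$, so the total mass is a
  multiple of $\Gamma(n/2)$.
\<close>
lemma integrable_inverse_power:
  "integrable lborel (\<lambda>x::'a::euclidean_space. 1 / (1 + (norm x)\<^sup>2) ^ DIM('a))"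
proof -
  define n where "n = real DIM('a)"
  have n: "n > 0" by (simp add: n_def)
  have "ennreal (Gamma n) * (\<integral>\<^sup>+(x::'a). ennreal (1 / (1 + (norm x)\<^sup>2) ^ DIM('a)) \<partial>lborel)
     = (\<integral>\<^sup>+(x::'a). (\<integral>\<^sup>+t\<in>{0<..}. ennreal (t powr (n - 1) * exp (- ((1 + (norm x)\<^sup>2) * t))) \<partial>lborel) \<partial>lborel)"
  proof -
    have "(\<integral>\<^sup>+t\<in>{0<..}. ennreal (t powr (n - 1) * exp (- ((1 + (norm x)\<^sup>2) * t))) \<partial>lborel)
      = ennreal (Gamma n) * ennreal (1 / (1 + (norm x)\<^sup>2) ^ DIM('a))" for x :: 'a
    proof -
      have "1 + (norm x)\<^sup>2 > 0" by (simp add: add_pos_nonneg)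
      moreover from this have "(1 + (norm x)\<^sup>2) powr n = (1 + (norm x)\<^sup>2) ^ DIM('a)"
        by (simp add: n_def powr_realpow)
      ultimately show ?thesis
        using n by (simp add: nn_integral_power_exp ennreal_mult'[symmetric] Gamma_real_pos less_imp_le)
    qed
    then show ?thesis by (simp add: nn_integral_cmult)
  qed
  also have "\<dots> = (\<integral>\<^sup>+t\<in>{0<..}. (\<integral>\<^sup>+(x::'a). ennreal (t powr (n - 1) * exp (- ((1 + (norm x)\<^sup>2) * t))) \<partial>lborel) \<partial>lborel)"
    by (subst lborel_pair.Fubini') (auto simp: nn_integral_multc)
  also have "\<dots> = (\<integral>\<^sup>+t\<in>{0<..}. ennreal (pi powr (n / 2)) * ennreal (t powr (n / 2 - 1) * exp (- (1 * t))) \<partial>lborel)"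
  proof (rule nn_integral_cong)
    fix t :: real
    have "(\<integral>\<^sup>+(x::'a). ennreal (t powr (n - 1) * exp (- ((1 + (norm x)\<^sup>2) * t))) \<partial>lborel)
       = ennreal (pi powr (n / 2)) * ennreal (t powr (n / 2 - 1) * exp (- (1 * t)))" if t: "t > 0"
    proof -
      have "t powr (n - 1) * exp (- ((1 + (norm x)\<^sup>2) * t)) = (pi powr (n / 2) * (t powr (n / 2 - 1) * exp (- (1 * t)))) * heat (pi / t) x" for x :: 'a
      proof -
        have "t powr (n - 1) = t powr (n / 2 - 1) * t powr (n / 2)"
          by (simp add: powr_add[symmetric])
        moreover have "exp (- ((1 + (norm x)\<^sup>2) * t)) = exp (- (1 * t)) * exp (- (t * (norm x)\<^sup>2))"
          by (simp add: exp_add[symmetric] algebra_simps)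
        ultimately show ?thesis
          using t by (simp add: heat_def n_def[symmetric] powr_divide)
      qed
      then show ?thesis
        using t by (simp add: ennreal_mult' nn_integral_cmult nn_integral_multc nn_integral_heat mult_ac)
    qed
    then show "(\<integral>\<^sup>+(x::'a). ennreal (t powr (n - 1) * exp (- ((1 + (norm x)\<^sup>2) * t))) \<partial>lborel) * indicator {0<..} t =
      ennreal (pi powr (n / 2)) * ennreal (t powr (n / 2 - 1) * exp (- (1 * t))) * indicator {0<..} t"
      by (cases "t > 0") auto
  qed
  also have "\<dots> = ennreal (pi powr (n / 2)) * (\<integral>\<^sup>+t\<in>{0<..}. ennreal (t powr (n / 2 - 1) * exp (- (1 * t))) \<partial>lborel)"
    by (simp add: mult.assoc nn_integral_cmult)
  also have "\<dots> = ennreal (pi powr (n / 2)) * ennreal (Gamma (n / 2) / 1 powr (n / 2))"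
    using n by (subst nn_integral_power_exp) auto
  also have "\<dots> < \<infinity>" by (simp add: ennreal_mult'[symmetric])
  finally have "ennreal (Gamma n) * (\<integral>\<^sup>+(x::'a). ennreal (1 / (1 + (norm x)\<^sup>2) ^ DIM('a)) \<partial>lborel) < \<infinity>" .
  then have "(\<integral>\<^sup>+(x::'a). ennreal (1 / (1 + (norm x)\<^sup>2) ^ DIM('a)) \<partial>lborel) < \<infinity>"
    using Gamma_real_pos[OF n] by (auto simp: ennreal_mult_less_top)
  then show ?thesis
    by (intro integrableI_bounded) auto
qed

lemma integrable_rapid_decay:
  fixes f :: "'a::euclidean_space \<Rightarrow> complex"
  assumes f: "f \<in> borel_measurable borel" and b: "\<And>k::nat. bounded (range (\<lambda>x. norm x ^ k *\<^sub>R f x))"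
  shows "integrable lborel f"
proof -
  let ?n = "DIM('a)"
  obtain A where A: "norm (norm x ^ 0 *\<^sub>R f x) \<le> A" for x using b[of 0] by (auto simp: bounded_iff)
  obtain B where B: "norm (norm x ^ (2 * ?n) *\<^sub>R f x) \<le> B" for x using b[of "2 * ?n"] unfolding bounded_iff by blast
  \<comment> \<open>$(1+|x|^2)^n \le 2^n (1+|x|^{2n})$, so the powers 0 and $2n$ already give an integrable bound.\<close>
  show ?thesis
  proof (rule Bochner_Integration.integrable_bound)
    show "integrable lborel (\<lambda>x::'a. (2 ^ ?n * (A + B)) * (1 / (1 + (norm x)\<^sup>2) ^ ?n))"
      by (intro integrable_mult_right integrable_inverse_power)
    show "AE x in lborel. norm (f x) \<le> norm ((2 ^ ?n * (A + B)) * (1 / (1 + (norm x)\<^sup>2) ^ ?n))"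
    proof (rule AE_I2)
      fix x :: 'a
      have "(1 + (norm x)\<^sup>2) ^ ?n \<le> (2 * max 1 ((norm x)\<^sup>2)) ^ ?n"
        by (intro power_mono) auto
      also have "\<dots> \<le> 2 ^ ?n * (1 + norm x ^ (2 * ?n))"
        by (simp add: power_mult_distrib max_def power_mult)
      finally have 1: "(1 + (norm x)\<^sup>2) ^ ?n \<le> 2 ^ ?n * (1 + norm x ^ (2 * ?n))" .
      have pos: "(1 + (norm x)\<^sup>2) ^ ?n > 0" by (simp add: add_pos_nonneg)
      have "norm (f x) * (1 + (norm x)\<^sup>2) ^ ?n \<le> norm (f x) * (2 ^ ?n * (1 + norm x ^ (2 * ?n)))"
        by (intro mult_left_mono 1) auto
      also have "\<dots> = 2 ^ ?n * (norm (f x) + norm x ^ (2 * ?n) * norm (f x))" by (simp add: algebra_simps)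
      also have "\<dots> \<le> 2 ^ ?n * (A + B)"
        using A[of x] B[of x] by (intro mult_left_mono add_mono) auto
      finally have "norm (f x) \<le> (2 ^ ?n * (A + B)) / (1 + (norm x)\<^sup>2) ^ ?n"
        using pos by (simp add: pos_le_divide_eq)
      then show "norm (f x) \<le> norm ((2 ^ ?n * (A + B)) * (1 / (1 + (norm x)\<^sup>2) ^ ?n))"
        using A[of x] B[of x] order.trans[OF norm_ge_zero A[of x]] order.trans[OF norm_ge_zero B[of x]] by (simp add: abs_mult)
    qed
  qed (use f in simp)
qed

text \<open>
  Integration by parts. Integrate \<open>\<phi> (x + b) - \<phi> x\<close>, written as the integral of the
  derivative along the segment, over \<open>x\<close>: the difference has integral 0 by translation invariance,
  and by Fubini and the same invariance the other side is the integral of the derivative.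
\<close>
lemma integral_directional_derivative_eq_0:
  fixes \<phi> :: "'a::euclidean_space \<Rightarrow> complex"
  assumes \<phi>: "integrable lborel \<phi>" and \<psi>: "integrable lborel (\<lambda>x. D x b)"
    and c: "continuous_on UNIV (\<lambda>x. D x b)" and D: "\<And>x. (\<phi> has_derivative D x) (at x)"
  shows "(LINT x|lborel. D x b) = 0"
proof -
  define \<psi> where "\<psi> = (\<lambda>x. D x b)"
  have [measurable]: "\<psi> \<in> borel_measurable borel"
    using borel_measurable_integrable[OF \<psi>] by (simp add: \<psi>_def)
  have [measurable]: "\<phi> \<in> borel_measurable borel"
    using borel_measurable_integrable[OF \<phi>] by simp
  have \<psi>i: "integrable lborel \<psi>" using \<psi> by (simp add: \<psi>_def)
  let ?f = "\<lambda>(t::real) x. indicator {0..1} t *\<^sub>R \<psi> (x + t *\<^sub>R b)"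
  have ftc: "(LINT t|lborel. ?f t x) = \<phi> (x + b) - \<phi> x" for x
  proof -
    have "((\<lambda>t. \<phi> (x + t *\<^sub>R b)) has_vector_derivative \<psi> (x + t *\<^sub>R b)) (at t within {0..1})" for t
    proof -
      have "((\<lambda>t. x + t *\<^sub>R b) has_derivative (\<lambda>h. h *\<^sub>R b)) (at t within {0..1})"
        by (auto intro!: derivative_eq_intros)
      from has_derivative_compose[OF this, of \<phi> "D (x + t *\<^sub>R b)"] D
      have "((\<lambda>t. \<phi> (x + t *\<^sub>R b)) has_derivative (\<lambda>h. D (x + t *\<^sub>R b) (h *\<^sub>R b))) (at t within {0..1})"
        by simp
      moreover have "D (x + t *\<^sub>R b) (h *\<^sub>R b) = h *\<^sub>R \<psi> (x + t *\<^sub>R b)" for h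
        using has_derivative_linear[OF D, of "x + t *\<^sub>R b"] by (simp add: \<psi>_def linear_scale)
      ultimately show ?thesis by (simp add: has_vector_derivative_def)
    qed
    moreover have "continuous_on {0..1} (\<lambda>t. \<psi> (x + t *\<^sub>R b))"
      by (rule continuous_on_compose2[OF c[folded \<psi>_def]]) (auto intro!: continuous_intros)
    ultimately show ?thesis
      using integral_FTC_atLeastAtMost[of 0 1 "\<lambda>t. \<phi> (x + t *\<^sub>R b)" "\<lambda>t. \<psi> (x + t *\<^sub>R b)"] by simp
  qed
  have int: "integrable (lborel \<Otimes>\<^sub>M lborel) (case_prod ?f)"
  proof (rule lborel_pair.Fubini_integrable)
    show "integrable lborel (\<lambda>t. LINT x|lborel. norm (case_prod ?f (t, x)))"
      using lborel_integral_shift[of "\<lambda>x. norm (\<psi> x)"] by simp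
    show "AE t in lborel. integrable lborel (\<lambda>x. case_prod ?f (t, x))"
      using lborel_integrable_shift[OF \<psi>i] by simp
  qed measurable
  have "(LINT t|lborel. LINT x|lborel. ?f t x) = (LINT t|lborel. indicator {0..1::real} t *\<^sub>R (LINT x|lborel. \<psi> x))"
    by (simp add: lborel_integral_shift)
  also have "\<dots> = (LINT x|lborel. \<psi> x)" by simp
  finally have "(LINT x|lborel. \<psi> x) = (LINT x|lborel. LINT t|lborel. ?f t x)"
    using lborel_pair.Fubini_integral[OF int] by simp
  also have "\<dots> = (LINT x|lborel. \<phi> (x + b)) - (LINT x|lborel. \<phi> x)"
    unfolding ftc using \<phi> lborel_integrable_shift[OF \<phi>] by (intro Bochner_Integration.integral_diff) auto
  also have "\<dots> = 0" by (simp add: lborel_integral_shift)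
  finally show ?thesis by (simp add: \<psi>_def)
qed

text \<open>
  The derivative of the product of \<open>f\<close> with the character has integral 0.
\<close>
lemma fourier_directional_derivative:
  fixes f :: "'a::euclidean_space \<Rightarrow> complex"
  assumes f: "integrable lborel f" and Df: "integrable lborel (\<lambda>x. frechet_derivative f (at x) b)"
    and c: "continuous_on UNIV (\<lambda>x. frechet_derivative f (at x) b)"
    and d: "\<And>x. f differentiable (at x)"
  shows "fourier (\<lambda>x. frechet_derivative f (at x) b) y = - (2 * of_real pi * \<i> * of_real (b \<bullet> y)) * fourier f y"
proof -
  let ?k = "2 * of_real pi * \<i> :: complex"
  let ?D = "\<lambda>x h. wave (x \<bullet> y) * frechet_derivative f (at x) h + (?k * of_real (h \<bullet> y) * wave (x \<bullet> y)) * f x"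
  have fc: "continuous_on UNIV f" using d by (simp add: differentiable_imp_continuous_on differentiable_on_def)
  have wc: "continuous_on UNIV (\<lambda>x. wave (x \<bullet> y))" unfolding wave_def by (intro continuous_intros)
  have D: "((\<lambda>x. wave (x \<bullet> y) * f x) has_derivative ?D x) (at x)" for x
  proof -
    have w: "((\<lambda>x. wave (x \<bullet> y)) has_derivative (\<lambda>h. ?k * of_real (h \<bullet> y) * wave (x \<bullet> y))) (at x)"
    proof -
      have "((\<lambda>x. ?k * of_real (x \<bullet> y)) has_derivative (\<lambda>h. ?k * of_real (h \<bullet> y))) (at x)"
        by (auto intro!: derivative_eq_intros)
      from has_derivative_compose[OF this, of exp "(*) (exp (?k * of_real (x \<bullet> y)))"]
      show ?thesis
        using DERIV_exp[of "?k * of_real (x \<bullet> y)"] by (simp add: wave_def has_field_derivative_def mult_ac)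
    qed
    show ?thesis
      using has_derivative_mult[OF w frechet_derivative_works[THEN iffD1, OF d]] by (simp add: mult_ac)
  qed
  have i1: "integrable lborel (\<lambda>x. wave (x \<bullet> y) * frechet_derivative f (at x) b)"
    by (intro integrable_wave_mult Df) auto
  have i2: "integrable lborel (\<lambda>x. wave (x \<bullet> y) * f x)"
    by (intro integrable_wave_mult f) auto
  have eq: "?D x b = wave (x \<bullet> y) * frechet_derivative f (at x) b + (?k * of_real (b \<bullet> y)) * (wave (x \<bullet> y) * f x)" for x
    by simp
  have "(LINT x|lborel. ?D x b) = 0"
  proof (rule integral_directional_derivative_eq_0[OF _ _ _ D])
    show "integrable lborel (\<lambda>x. ?D x b)"
      unfolding eq by (intro Bochner_Integration.integrable_add i1 integrable_mult_right i2)
    show "continuous_on UNIV (\<lambda>x. ?D x b)"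
      unfolding eq by (intro continuous_intros c fc wc)
  qed (use i2 in simp)
  also have "(LINT x|lborel. ?D x b) = fourier (\<lambda>x. frechet_derivative f (at x) b) y + (?k * of_real (b \<bullet> y)) * fourier f y"
    unfolding eq fourier_wave by (subst Bochner_Integration.integral_add) (use i1 i2 in auto)
  finally show ?thesis by (simp add: add_eq_0_iff)
qed

lemma schwartzD:
  assumes "f \<in> schwartz" "set bs \<subseteq> Basis"
  shows "iterated_partial bs f differentiable (at x)" "bounded (range (\<lambda>x. norm x ^ k *\<^sub>R iterated_partial bs f x))"
  using assms by (auto simp: schwartz_def)

text \<open>
  Iterated partial derivatives of a Schwartz function are differentiable, hence continuous and
  measurable, and decay rapidly.
\<close>
lemma schwartz_continuous_integrable:
  assumes "f \<in> schwartz" "set bs \<subseteq> Basis"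
  shows "continuous_on UNIV (iterated_partial bs f)" "integrable lborel (iterated_partial bs f)"
proof -
  show c: "continuous_on UNIV (iterated_partial bs f)"
    using schwartzD(1)[OF assms] by (simp add: differentiable_imp_continuous_on differentiable_on_def)
  show "integrable lborel (iterated_partial bs f)"
    by (intro integrable_rapid_decay schwartzD(2)[OF assms] borel_measurable_continuous_onI c)
qed

lemma fourier_iterated_partial:
  assumes g: "g \<in> schwartz" and b: "b \<in> Basis"
  shows "fourier (iterated_partial (replicate k b) g) y = (- (2 * of_real pi * \<i> * of_real (b \<bullet> y))) ^ k * fourier g y"
proof (induction k)
  case 0
  then show ?case by simp
next
  case (Suc k)
  have s: "set (replicate k b) \<subseteq> Basis" "set (replicate (Suc k) b) \<subseteq> Basis" using b by auto
  note c = schwartz_continuous_integrable[OF g s(2)]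
  show ?case
    using fourier_directional_derivative[OF schwartz_continuous_integrable(2)[OF g s(1)], of b y] c schwartzD(1)[OF g s(1)] Suc
    by simp
qed

text \<open>
  Differentiating \<open>k\<close> times along a basis vector \<open>b\<close> controls $|b\cdot y|^k |\hat g(y)|$, and at every
  \<open>y\<close> some coordinate is at least $|y|/n$. Pure derivatives therefore suffice.
\<close>
lemma bounded_fourier_schwartz:
  fixes g :: "'a::euclidean_space \<Rightarrow> complex"
  assumes g: "g \<in> schwartz"
  shows "bounded (range (\<lambda>y. norm y ^ k *\<^sub>R fourier g y))"
proof -
  define C where "C b = (LINT x|lborel. norm (iterated_partial (replicate k b) g x))" for b
  have C: "\<bar>b \<bullet> y\<bar> ^ k * norm (fourier g y) \<le> C b" if "b \<in> Basis" for b y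
  proof -
    have "\<bar>b \<bullet> y\<bar> ^ k * norm (fourier g y) \<le> \<bar>2 * pi * (b \<bullet> y)\<bar> ^ k * norm (fourier g y)"
    proof (intro mult_right_mono power_mono)
      have "1 * \<bar>b \<bullet> y\<bar> \<le> (2 * pi) * \<bar>b \<bullet> y\<bar>" using pi_gt3 by (intro mult_right_mono) auto
      then show "\<bar>b \<bullet> y\<bar> \<le> \<bar>2 * pi * (b \<bullet> y)\<bar>" by (simp add: abs_mult)
    qed auto
    also have "\<dots> = norm (fourier (iterated_partial (replicate k b) g) y)"
      by (simp add: fourier_iterated_partial[OF g that] norm_mult norm_power abs_mult power_mult_distrib)
    also have "\<dots> \<le> C b" unfolding C_def by (rule norm_fourier_le)
    finally show ?thesis .
  qed
  have "norm (norm y ^ k *\<^sub>R fourier g y) \<le> real DIM('a) ^ k * (\<Sum>b\<in>Basis. C b)" for y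
  proof -
    obtain b where b: "b \<in> Basis" and mx: "\<And>i. i \<in> Basis \<Longrightarrow> \<bar>y \<bullet> i\<bar> \<le> \<bar>y \<bullet> b\<bar>"
    proof -
      have "Max ((\<lambda>i. \<bar>y \<bullet> i\<bar>) ` Basis) \<in> (\<lambda>i. \<bar>y \<bullet> i\<bar>) ` Basis" by (intro Max_in) auto
      then obtain b where b: "b \<in> Basis" "Max ((\<lambda>i. \<bar>y \<bullet> i\<bar>) ` Basis) = \<bar>y \<bullet> b\<bar>" by (elim imageE)
      have "\<bar>y \<bullet> i\<bar> \<le> \<bar>y \<bullet> b\<bar>" if "i \<in> Basis" for i
        unfolding b(2)[symmetric] using that by (intro Max_ge) auto
      with b(1) show ?thesis by (rule that)
    qed
    have "norm y \<le> (\<Sum>i\<in>Basis. \<bar>y \<bullet> i\<bar>)" by (rule norm_le_l1)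
    also have "\<dots> \<le> (\<Sum>i\<in>(Basis::'a set). \<bar>y \<bullet> b\<bar>)" by (intro sum_mono mx)
    finally have "norm y \<le> real DIM('a) * \<bar>b \<bullet> y\<bar>" by (simp add: inner_commute)
    then have "norm y ^ k \<le> (real DIM('a) * \<bar>b \<bullet> y\<bar>) ^ k" by (intro power_mono) auto
    then have "norm (norm y ^ k *\<^sub>R fourier g y) \<le> (real DIM('a) * \<bar>b \<bullet> y\<bar>) ^ k * norm (fourier g y)"
      by (simp add: mult_right_mono)
    also have "\<dots> \<le> real DIM('a) ^ k * C b"
      using C[OF b, of y] by (simp add: power_mult_distrib mult.assoc mult_left_mono)
    also have "\<dots> \<le> real DIM('a) ^ k * (\<Sum>b\<in>Basis. C b)"
      using b by (intro mult_left_mono member_le_sum) (auto simp: C_def)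
    finally show ?thesis .
  qed
  then show ?thesis unfolding bounded_iff by blast
qed

lemma schwartz_fourier_power_integrable:
  fixes g :: "'a::euclidean_space \<Rightarrow> complex"
  assumes g: "g \<in> schwartz" and s: "s \<ge> 0"
  shows "integrable lborel (\<lambda>y. of_real ((2 * pi * norm y) powr s) * fourier g y)"
proof (rule integrable_rapid_decay)
  have [measurable]: "g \<in> borel_measurable borel"
    using schwartz_continuous_integrable(1)[OF g, of "[]"] by (simp add: borel_measurable_continuous_onI)
  show "(\<lambda>y. of_real ((2 * pi * norm y) powr s) * fourier g y) \<in> borel_measurable borel"
    by measurable
  fix k :: nat
  \<comment> \<open>$r^s \le 1 + r^m$ for the least integer $m \ge s$ reduces real to integer powers.\<close>
  define m where "m = nat \<lceil>s\<rceil>"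
  have m: "s \<le> real m" by (simp add: m_def) linarith
  obtain A where A: "norm (norm y ^ k *\<^sub>R fourier g y) \<le> A" for y
    using bounded_fourier_schwartz[OF g, of k] unfolding bounded_iff by blast
  obtain B where B: "norm (norm y ^ (k + m) *\<^sub>R fourier g y) \<le> B" for y
    using bounded_fourier_schwartz[OF g, of "k + m"] unfolding bounded_iff by blast
  have "norm (norm y ^ k *\<^sub>R (of_real ((2 * pi * norm y) powr s) * fourier g y)) \<le> A + (2 * pi) ^ m * B" for y
  proof -
    let ?r = "2 * pi * norm y"
    have r0: "?r \<ge> 0" by simp
    have "?r powr s \<le> 1 + ?r ^ m"
    proof (cases "?r \<le> 1")
      case True
      then have "?r powr s \<le> 1" using s r0 by (intro powr_le1) auto
      then show ?thesis using r0 by (metis add_increasing2 zero_le_power)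
    next
      case False
      then have "?r powr s \<le> ?r powr real m" using m by (intro powr_mono) auto
      also have "\<dots> = ?r ^ m" using False by (intro powr_realpow) auto
      finally show ?thesis by simp
    qed
    then have "norm y ^ k * ?r powr s * norm (fourier g y) \<le> norm y ^ k * (1 + ?r ^ m) * norm (fourier g y)"
      by (intro mult_right_mono mult_left_mono) auto
    also have "\<dots> = norm y ^ k * norm (fourier g y) + (2 * pi) ^ m * (norm y ^ (k + m) * norm (fourier g y))"
      by (simp add: algebra_simps power_mult_distrib power_add)
    also have "\<dots> \<le> A + (2 * pi) ^ m * B"
      using A[of y] B[of y] by (intro add_mono mult_left_mono) auto
    finally show ?thesis by (simp add: norm_mult mult.assoc)
  qed
  then show "bounded (range (\<lambda>y. norm y ^ k *\<^sub>R (of_real ((2 * pi * norm y) powr s) * fourier g y)))"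
    unfolding bounded_iff by blast
qed

section \<open>Gaussian regularisation and Fourier inversion\<close>

lemma heat_fourier_wave:
  fixes y :: "'a::euclidean_space"
  assumes t: "t > 0"
  shows "has_bochner_integral lborel (\<lambda>x::'a. complex_of_real (heat t x) * wave (x \<bullet> y))
     (complex_of_real (exp (- (pi * t * (norm y)\<^sup>2))))"
  using heat_fourier[OF t] by (simp add: wave_def)

text \<open>
  The Fourier pair read backwards: a Gaussian is a multiple of the heat kernel at time \<open>1 / t\<close>.
\<close>
lemma gaussian_fourier_wave:
  fixes z :: "'a::euclidean_space"
  assumes t: "t > 0"
  shows "has_bochner_integral lborel (\<lambda>\<xi>::'a. exp (- (pi * t * (norm \<xi>)\<^sup>2)) *\<^sub>R wave (\<xi> \<bullet> z)) (of_real (heat t z))"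
proof -
  let ?c = "1 / t powr (DIM('a) / 2)"
  have "has_bochner_integral lborel (\<lambda>\<xi>::'a. ?c *\<^sub>R (of_real (heat (1 / t) \<xi>) * wave (\<xi> \<bullet> z))) (?c *\<^sub>R of_real (exp (- (pi * (1 / t) * (norm z)\<^sup>2))))"
    using t by (intro has_bochner_integral_scaleR_right heat_fourier_wave) simp
  moreover have "?c * heat (1 / t) \<xi> = exp (- (pi * t * (norm \<xi>)\<^sup>2))" for \<xi> :: 'a
    using t by (simp add: heat_def powr_divide mult_ac)
  then have "?c *\<^sub>R (of_real (heat (1 / t) \<xi>) * wave (\<xi> \<bullet> z)) = exp (- (pi * t * (norm \<xi>)\<^sup>2)) *\<^sub>R wave (\<xi> \<bullet> z)" for \<xi> :: 'a
    by (simp only: scaleR_conv_of_real mult.assoc[symmetric] of_real_mult[symmetric])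
  moreover have "?c *\<^sub>R of_real (exp (- (pi * (1 / t) * (norm z)\<^sup>2))) = (of_real (heat t z) :: complex)"
    by (simp add: heat_def scaleR_conv_of_real)
  ultimately show ?thesis by simp
qed

lemma integrable_gaussian:
  assumes t: "t > 0"
  shows "integrable lborel (\<lambda>\<xi>::'a::euclidean_space. exp (- (pi * t * (norm \<xi>)\<^sup>2)))"
proof -
  have "integrable lborel (\<lambda>\<xi>::'a. norm (exp (- (pi * t * (norm \<xi>)\<^sup>2)) *\<^sub>R wave (\<xi> \<bullet> 0)))"
    using gaussian_fourier_wave[OF t, of "0::'a"] by (intro integrable_norm) (simp add: has_bochner_integral_iff)
  then show ?thesis by simp
qed

lemma integrable_heat_diff:
  fixes x :: "'a::euclidean_space"
  assumes "t > 0" shows "integrable lborel (\<lambda>y. heat t (x - y))"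
  unfolding heat_minus_commute[of t x]
  using lborel_integrable_shift[OF integrable_heat[OF assms], of "- x"] by simp

text \<open>
  Fubini moves the heat kernel inside the Fourier integral, where it becomes its own Fourier transform.
\<close>
lemma heat_convolution_inverse_fourier:
  fixes F :: "'a::euclidean_space \<Rightarrow> complex"
  assumes F: "integrable lborel F" and t: "t > 0"
  shows "(LINT y|lborel. heat t (x - y) *\<^sub>R inverse_fourier F y)
    = (LINT \<xi>|lborel. exp (- (pi * t * (norm \<xi>)\<^sup>2)) *\<^sub>R (wave (- (x \<bullet> \<xi>)) * F \<xi>))"
proof -
  have [measurable]: "F \<in> borel_measurable borel" using borel_measurable_integrable[OF F] by simp
  let ?f = "\<lambda>y \<xi>. heat t (x - y) *\<^sub>R (wave (- (y \<bullet> \<xi>)) * F \<xi>)"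
  have int: "integrable (lborel \<Otimes>\<^sub>M lborel) (case_prod ?f)"
  proof (rule lborel_pair.Fubini_integrable)
    show "integrable lborel (\<lambda>y. LINT \<xi>|lborel. norm (case_prod ?f (y, \<xi>)))"
      using integrable_heat_diff[OF t, of x] by (simp add: norm_mult)
    show "AE y in lborel. integrable lborel (\<lambda>\<xi>. case_prod ?f (y, \<xi>))"
      by (intro AE_I2) (auto intro!: integrable_scaleR_right integrable_wave_mult F)
  qed measurable
  have inner: "(LINT y|lborel. ?f y \<xi>) = exp (- (pi * t * (norm \<xi>)\<^sup>2)) *\<^sub>R (wave (- (x \<bullet> \<xi>)) * F \<xi>)" for \<xi>
  proof -
    have "(LINT y|lborel. ?f y \<xi>) = (LINT y|lborel. ?f (y + x) \<xi>)"
      by (rule lborel_integral_shift[symmetric]) measurable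
    also have "\<dots> = (LINT y|lborel. (of_real (heat t y) * wave (y \<bullet> (- \<xi>))) * (wave (- (x \<bullet> \<xi>)) * F \<xi>))"
      by (intro Bochner_Integration.integral_cong refl)
        (simp add: inner_add_left wave_add[symmetric] heat_def scaleR_conv_of_real mult.assoc[symmetric])
    also have "\<dots> = of_real (exp (- (pi * t * (norm (- \<xi>))\<^sup>2))) * (wave (- (x \<bullet> \<xi>)) * F \<xi>)"
      using heat_fourier_wave[OF t, of "- \<xi>"] by (simp add: has_bochner_integral_iff)
    finally show ?thesis by (simp add: scaleR_conv_of_real)
  qed
  have "(LINT y|lborel. heat t (x - y) *\<^sub>R inverse_fourier F y) = (LINT y|lborel. LINT \<xi>|lborel. ?f y \<xi>)"
    by (simp add: inverse_fourier_wave)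
  also have "\<dots> = (LINT \<xi>|lborel. LINT y|lborel. ?f y \<xi>)"
    by (rule lborel_pair.Fubini_integral[OF int, symmetric])
  finally show ?thesis by (simp only: inner)
qed

text \<open>
  The Gaussian factor makes the double integral absolutely convergent, so it can be exchanged.
  As \<open>t\<close> tends to 0 the two sides become the two sides of the inversion formula.
\<close>
lemma gaussian_mean_fourier:
  fixes F :: "'a::euclidean_space \<Rightarrow> complex"
  assumes F: "integrable lborel F" and t: "t > 0"
  shows "(LINT \<xi>|lborel. exp (- (pi * t * (norm \<xi>)\<^sup>2)) *\<^sub>R (wave (- (x \<bullet> \<xi>)) * fourier F \<xi>))
    = (LINT y|lborel. heat t (x - y) *\<^sub>R F y)"
proof -
  have [measurable]: "F \<in> borel_measurable borel" using borel_measurable_integrable[OF F] by simp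
  let ?f = "\<lambda>\<xi> y. exp (- (pi * t * (norm \<xi>)\<^sup>2)) *\<^sub>R (wave (- (x \<bullet> \<xi>)) * (wave (y \<bullet> \<xi>) * F y))"
  have int: "integrable (lborel \<Otimes>\<^sub>M lborel) (case_prod ?f)"
  proof (rule lborel_pair.Fubini_integrable)
    show "integrable lborel (\<lambda>\<xi>. LINT y|lborel. norm (case_prod ?f (\<xi>, y)))"
      using integrable_gaussian[OF t, where 'a='a] by (simp add: norm_mult)
    show "AE \<xi> in lborel. integrable lborel (\<lambda>y. case_prod ?f (\<xi>, y))"
      by (intro AE_I2) (auto intro!: integrable_scaleR_right integrable_mult_right integrable_wave_mult F)
  qed measurable
  have inner: "(LINT \<xi>|lborel. ?f \<xi> y) = heat t (x - y) *\<^sub>R F y" for y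
  proof -
    have "(LINT \<xi>|lborel. ?f \<xi> y) = (LINT \<xi>|lborel. (exp (- (pi * t * (norm \<xi>)\<^sup>2)) *\<^sub>R wave (\<xi> \<bullet> (y - x))) * F y)"
      by (intro Bochner_Integration.integral_cong refl)
        (simp add: mult.assoc[symmetric] wave_add[symmetric] inner_diff_right inner_commute)
    also have "\<dots> = of_real (heat t (y - x)) * F y"
      using gaussian_fourier_wave[OF t, of "y - x"] by (simp only: integral_mult_left_zero has_bochner_integral_iff)
    finally show ?thesis by (simp add: scaleR_conv_of_real heat_minus_commute)
  qed
  have "(LINT \<xi>|lborel. exp (- (pi * t * (norm \<xi>)\<^sup>2)) *\<^sub>R (wave (- (x \<bullet> \<xi>)) * fourier F \<xi>)) = (LINT \<xi>|lborel. LINT y|lborel. ?f \<xi> y)"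
    by (simp add: fourier_wave)
  also have "\<dots> = (LINT y|lborel. LINT \<xi>|lborel. ?f \<xi> y)"
    by (rule lborel_pair.Fubini_integral[OF int, symmetric])
  finally show ?thesis by (simp only: inner)
qed

lemma heat_convolution_rescale:
  fixes g :: "'a::euclidean_space \<Rightarrow> complex"
  assumes [measurable]: "g \<in> borel_measurable borel" and c: "c > 0"
  shows "(LINT y|lborel. heat (c\<^sup>2) (x - y) *\<^sub>R g y) = (LINT z|lborel. heat 1 z *\<^sub>R g (x + c *\<^sub>R z))"
proof -
  have "(LINT y|lborel. heat (c\<^sup>2) (x - y) *\<^sub>R g y) = (LINT z|lborel. c ^ DIM('a) *\<^sub>R (heat (c\<^sup>2) (x - (x + c *\<^sub>R z)) *\<^sub>R g (x + c *\<^sub>R z)))"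
    using c by (subst lborel_affine[of c x]) (simp_all add: integral_density integral_distr)
  also have "c ^ DIM('a) * heat (c\<^sup>2) (x - (x + c *\<^sub>R z)) = heat 1 z" for z
  proof -
    have "(c\<^sup>2) powr (DIM('a) / 2) = c ^ DIM('a)"
      using c by (simp add: powr_powr powr_realpow[symmetric] flip: powr_numeral)
    then show ?thesis using c by (simp add: heat_def power_mult_distrib)
  qed
  then have "(LINT z|lborel. c ^ DIM('a) *\<^sub>R (heat (c\<^sup>2) (x - (x + c *\<^sub>R z)) *\<^sub>R g (x + c *\<^sub>R z))) = (LINT z|lborel. heat 1 z *\<^sub>R g (x + c *\<^sub>R z))"
    by (simp only: scaleR_scaleR)
  finally show ?thesis .
qed

text \<open>
  After rescaling, the kernel is fixed and only the argument of \<open>g\<close> moves, so dominated convergence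
  applies. Times are taken as squares to keep the rescaling free of roots.
\<close>
lemma heat_approximate_identity:
  fixes g :: "'a::euclidean_space \<Rightarrow> complex"
  assumes g: "continuous_on UNIV g" and C: "\<And>x. norm (g x) \<le> C"
  shows "(\<lambda>k. LINT y|lborel. heat ((1 / real (Suc k))\<^sup>2) (x - y) *\<^sub>R g y) \<longlonglongrightarrow> g x"
proof -
  have [measurable]: "g \<in> borel_measurable borel" using g by (rule borel_measurable_continuous_onI)
  have h1: "(LINT z|lborel. heat 1 (z::'a)) = 1"
    using heat_fourier_wave[of 1 "0::'a"] by (simp add: has_bochner_integral_iff)
  have "(\<lambda>k. LINT z|lborel. heat 1 z *\<^sub>R g (x + (1 / real (Suc k)) *\<^sub>R z)) \<longlonglongrightarrow> (LINT z|lborel. heat 1 (z::'a) *\<^sub>R g x)"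
  proof (rule integral_dominated_convergence)
    show "integrable lborel (\<lambda>z::'a. heat 1 z * C)"
      by (intro integrable_mult_left integrable_heat) simp
    have "(\<lambda>k. x + (1 / real (Suc k)) *\<^sub>R z) \<longlonglongrightarrow> x + 0 *\<^sub>R z" for z
      by (intro tendsto_intros LIMSEQ_inverse_real_of_nat[unfolded inverse_eq_divide])
    then have "(\<lambda>k. g (x + (1 / real (Suc k)) *\<^sub>R z)) \<longlonglongrightarrow> g (x + 0 *\<^sub>R z)" for z
      by (intro continuous_on_tendsto_compose[OF g]) auto
    then show "AE z in lborel. (\<lambda>k. heat 1 z *\<^sub>R g (x + (1 / real (Suc k)) *\<^sub>R z)) \<longlonglongrightarrow> heat 1 z *\<^sub>R g x"
      by (intro AE_I2 tendsto_intros) simp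
    show "AE z in lborel. norm (heat 1 z *\<^sub>R g (x + (1 / real (Suc k)) *\<^sub>R z)) \<le> heat 1 z * C" for k
      by (intro AE_I2) (simp add: C mult_left_mono)
  qed measurable
  also have "(LINT z|lborel. heat 1 (z::'a) *\<^sub>R g x) = g x"
    by (simp add: h1 integrable_heat)
  finally show ?thesis by (subst heat_convolution_rescale) auto
qed

text \<open>
  In \<open>gaussian_mean_fourier\<close> let the time tend to 0: the Fourier side converges by dominated
  convergence, the other side because the heat kernel is an approximate identity.
\<close>
lemma fourier_inversion:
  fixes g :: "'a::euclidean_space \<Rightarrow> complex"
  assumes g: "continuous_on UNIV g" "\<And>x. norm (g x) \<le> C" "integrable lborel g" and fg: "integrable lborel (fourier g)"
  shows "inverse_fourier (fourier g) x = g x"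
proof -
  have [measurable]: "fourier g \<in> borel_measurable borel" using borel_measurable_integrable[OF fg] by simp
  have "(\<lambda>k. LINT \<xi>|lborel. exp (- (pi * (1 / real (Suc k))\<^sup>2 * (norm \<xi>)\<^sup>2)) *\<^sub>R (wave (- (x \<bullet> \<xi>)) * fourier g \<xi>))
     \<longlonglongrightarrow> (LINT \<xi>|lborel. wave (- (x \<bullet> \<xi>)) * fourier g \<xi>)"
  proof (rule integral_dominated_convergence)
    show "integrable lborel (\<lambda>\<xi>. norm (fourier g \<xi>))" using fg by simp
    have "(\<lambda>k. exp (- (pi * (1 / real (Suc k))\<^sup>2 * (norm \<xi>)\<^sup>2)) *\<^sub>R (wave (- (x \<bullet> \<xi>)) * fourier g \<xi>))
       \<longlonglongrightarrow> exp (- (pi * 0\<^sup>2 * (norm \<xi>)\<^sup>2)) *\<^sub>R (wave (- (x \<bullet> \<xi>)) * fourier g \<xi>)" for \<xi> :: 'a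
      by (intro tendsto_intros LIMSEQ_inverse_real_of_nat[unfolded inverse_eq_divide])
    then show "AE \<xi> in lborel. (\<lambda>k. exp (- (pi * (1 / real (Suc k))\<^sup>2 * (norm \<xi>)\<^sup>2)) *\<^sub>R (wave (- (x \<bullet> \<xi>)) * fourier g \<xi>))
       \<longlonglongrightarrow> wave (- (x \<bullet> \<xi>)) * fourier g \<xi>"
      by simp
    show "AE \<xi> in lborel. norm (exp (- (pi * (1 / real (Suc k))\<^sup>2 * (norm \<xi>)\<^sup>2)) *\<^sub>R (wave (- (x \<bullet> \<xi>)) * fourier g \<xi>)) \<le> norm (fourier g \<xi>)" for k
      by (intro AE_I2) (simp add: norm_mult mult_left_le_one_le)
  qed measurable
  then have "(\<lambda>k. LINT y|lborel. heat ((1 / real (Suc k))\<^sup>2) (x - y) *\<^sub>R g y) \<longlonglongrightarrow> inverse_fourier (fourier g) x"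
    by (subst (asm) gaussian_mean_fourier) (auto simp: g inverse_fourier_wave)
  then show ?thesis
    using heat_approximate_identity[OF g(1,2), of x] LIMSEQ_unique by blast
qed

section \<open>The Riesz potential dominates the function\<close>

text \<open>
  The Fourier multipliers of the heat flow average, with weight $t^{s/2-1}$, to a multiple of
  $|\xi|^{-s}$, so the symbol of $(-\Delta)^{s/2}$ is cancelled.
\<close>
lemma riesz_symbol_superposition:
  fixes \<xi> :: "'a::euclidean_space"
  assumes s: "s > 0" and \<xi>: "\<xi> \<noteq> 0"
  shows "(\<integral>\<^sup>+t\<in>{0<..}. ennreal (t powr (s/2 - 1) * exp (- (pi * t * (norm \<xi>)\<^sup>2)) * (2 * pi * norm \<xi>) powr s) \<partial>lborel)
    = ennreal (Gamma (s/2) * pi powr (s/2) * 2 powr s)"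
proof -
  define r where "r = norm \<xi>"
  have r: "r > 0" using \<xi> by (simp add: r_def)
  have "(\<integral>\<^sup>+t\<in>{0<..}. ennreal (t powr (s/2 - 1) * exp (- (pi * t * r\<^sup>2)) * (2 * pi * r) powr s) \<partial>lborel)
    = (\<integral>\<^sup>+t. ennreal ((2 * pi * r) powr s) * (ennreal (t powr (s/2 - 1) * exp (- ((pi * r\<^sup>2) * t))) * indicator {0<..} t) \<partial>lborel)"
    by (intro nn_integral_cong) (simp add: ennreal_mult' mult_ac)
  also have "\<dots> = ennreal ((2 * pi * r) powr s) * ennreal (Gamma (s/2) / (pi * r\<^sup>2) powr (s/2))"
    using s r by (simp add: nn_integral_cmult nn_integral_power_exp)
  also have "\<dots> = ennreal ((2 * pi * r) powr s * (Gamma (s/2) / (pi * r\<^sup>2) powr (s/2)))"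
    by (rule ennreal_mult'[symmetric]) simp
  also have "(2 * pi * r) powr s * (Gamma (s/2) / (pi * r\<^sup>2) powr (s/2)) = Gamma (s/2) * pi powr (s/2) * 2 powr s"
  proof -
    have 1: "(pi * r\<^sup>2) powr (s/2) = pi powr (s/2) * r powr s"
      using r by (simp add: powr_mult powr_powr flip: powr_numeral)
    have "pi powr s = pi powr (s/2) * pi powr (s/2)" by (simp add: powr_add[symmetric])
    then have 2: "(2 * pi * r) powr s = 2 powr s * (pi powr (s/2) * pi powr (s/2)) * r powr s"
      using r by (simp add: powr_mult)
    show ?thesis unfolding 1 2 using r by (simp add: field_simps)
  qed
  finally show ?thesis by (simp add: r_def)
qed

text \<open>
  The Riesz potential of $(-\Delta)^{s/2}g$ as an iterated integral in which the time variable comes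
  last. In this order every integral converges absolutely on the Fourier side, because $\hat g$ and
  $|\xi|^s\hat g$ are integrable. Averaging cancels the symbol, and what is left is the
  inverse Fourier transform of $\hat g$.
\<close>
lemma frac_laplacian_heat_representation:
  fixes g :: "'a::euclidean_space \<Rightarrow> complex"
  assumes g: "g \<in> schwartz" and s: "s > 0"
  shows "(LINT t|lborel. indicator {0<..} t *\<^sub>R (t powr (s/2 - 1) *\<^sub>R (LINT y|lborel. heat t (x - y) *\<^sub>R frac_laplacian s g y)))
    = (Gamma (s/2) * pi powr (s/2) * 2 powr s) *\<^sub>R g x"
proof -
  define D where "D = Gamma (s/2) * pi powr (s/2) * 2 powr s"
  have D: "D > 0" using s by (simp add: D_def Gamma_real_pos)
  define M where "M = (\<lambda>y. of_real ((2 * pi * norm y) powr s) * fourier g y)"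
  have Mi: "integrable lborel M" unfolding M_def using g s by (intro schwartz_fourier_power_integrable) auto
  have [measurable]: "M \<in> borel_measurable borel" using borel_measurable_integrable[OF Mi] by simp
  have fgi: "integrable lborel (fourier g)"
  proof (rule integrable_rapid_decay)
    have "g \<in> borel_measurable borel"
      using schwartz_continuous_integrable(1)[OF g, of "[]"] by (simp add: borel_measurable_continuous_onI)
    then show "fourier g \<in> borel_measurable borel" by measurable
  qed (rule bounded_fourier_schwartz[OF g])
  then have [measurable]: "fourier g \<in> borel_measurable borel" by (auto dest: borel_measurable_integrable)
  let ?k = "\<lambda>t \<xi>. indicator {0<..} t * (t powr (s/2 - 1) * exp (- (pi * t * (norm \<xi>)\<^sup>2)) * (2 * pi * norm \<xi>) powr s)"
  let ?f = "\<lambda>t \<xi>. ?k t \<xi> *\<^sub>R (wave (- (x \<bullet> \<xi>)) * fourier g \<xi>)"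
  have kb: "has_bochner_integral lborel (\<lambda>t. ?k t \<xi>) D" if "\<xi> \<noteq> 0" for \<xi> :: 'a
    using riesz_symbol_superposition[OF s that] D
    by (intro has_bochner_integral_nn_integral) (auto simp: D_def ennreal_mult' ennreal_indicator mult_ac)
  have ae0: "AE \<xi> in (lborel :: 'a measure). \<xi> \<noteq> 0" by (rule AE_lborel_singleton)
  \<comment> \<open>The superposition formula fails at the single frequency 0, where the symbol vanishes.\<close>
  have inner: "AE \<xi> in lborel. integrable lborel (\<lambda>t. ?f t \<xi>) \<and> (LINT t|lborel. ?f t \<xi>) = D *\<^sub>R (wave (- (x \<bullet> \<xi>)) * fourier g \<xi>)
     \<and> (LINT t|lborel. norm (?f t \<xi>)) = D * norm (fourier g \<xi>)"
    using ae0
  proof eventually_elim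
    case (elim \<xi>)
    have "(LINT t|lborel. norm (?f t \<xi>)) = (LINT t|lborel. ?k t \<xi> * norm (fourier g \<xi>))"
      by (intro Bochner_Integration.integral_cong refl) (simp add: norm_mult abs_mult)
    then show ?case using kb[OF elim] by (auto simp: has_bochner_integral_iff)
  qed
  have int: "integrable (lborel \<Otimes>\<^sub>M lborel) (\<lambda>(\<xi>, t). ?f t \<xi>)"
  proof (rule lborel_pair.Fubini_integrable)
    show "integrable lborel (\<lambda>\<xi>. LINT t|lborel. norm (case_prod (\<lambda>\<xi> t. ?f t \<xi>) (\<xi>, t)))"
    proof (subst integrable_cong_AE)
      show "AE \<xi> in lborel. (LINT t|lborel. norm (case_prod (\<lambda>\<xi> t. ?f t \<xi>) (\<xi>, t))) = D * norm (fourier g \<xi>)"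
        using inner by eventually_elim simp
    qed (use fgi in auto)
    show "AE \<xi> in lborel. integrable lborel (\<lambda>t. case_prod (\<lambda>\<xi> t. ?f t \<xi>) (\<xi>, t))"
      using inner by eventually_elim simp
  qed measurable
  have "(LINT t|lborel. indicator {0<..} t *\<^sub>R (t powr (s/2 - 1) *\<^sub>R (LINT y|lborel. heat t (x - y) *\<^sub>R frac_laplacian s g y)))
     = (LINT t|lborel. LINT \<xi>|lborel. ?f t \<xi>)"
  proof (rule Bochner_Integration.integral_cong[OF refl])
    fix t :: real
    show "indicator {0<..} t *\<^sub>R (t powr (s/2 - 1) *\<^sub>R (LINT y|lborel. heat t (x - y) *\<^sub>R frac_laplacian s g y)) = (LINT \<xi>|lborel. ?f t \<xi>)"
    proof (cases "t > 0")
      case True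
      have "frac_laplacian s g = inverse_fourier M" by (simp add: frac_laplacian_def fourier_multiplier_def M_def)
      then have "(LINT y|lborel. heat t (x - y) *\<^sub>R frac_laplacian s g y) = (LINT \<xi>|lborel. exp (- (pi * t * (norm \<xi>)\<^sup>2)) *\<^sub>R (wave (- (x \<bullet> \<xi>)) * M \<xi>))"
        using heat_convolution_inverse_fourier[OF Mi True] by simp
      then have "t powr (s/2 - 1) *\<^sub>R (LINT y|lborel. heat t (x - y) *\<^sub>R frac_laplacian s g y)
        = (LINT \<xi>|lborel. t powr (s/2 - 1) *\<^sub>R (exp (- (pi * t * (norm \<xi>)\<^sup>2)) *\<^sub>R (wave (- (x \<bullet> \<xi>)) * M \<xi>)))"
        by (simp only: integral_scaleR_right)
      also have "\<dots> = (LINT \<xi>|lborel. ?f t \<xi>)"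
        using True by (intro Bochner_Integration.integral_cong refl) (simp add: M_def scaleR_conv_of_real mult_ac)
      finally show ?thesis using True by simp
    qed simp
  qed
  also have "\<dots> = (LINT \<xi>|lborel. LINT t|lborel. ?f t \<xi>)"
    using lborel_pair.Fubini_integral[OF int] by simp
  also have "\<dots> = (LINT \<xi>|lborel. D *\<^sub>R (wave (- (x \<bullet> \<xi>)) * fourier g \<xi>))"
    using inner by (intro integral_cong_AE) (auto elim: eventually_mono)
  also have "\<dots> = D *\<^sub>R inverse_fourier (fourier g) x" by (simp add: inverse_fourier_wave)
  also have "inverse_fourier (fourier g) x = g x"
  proof -
    obtain C where "norm (norm x ^ 0 *\<^sub>R g x) \<le> C" for x
      using schwartzD(2)[OF g, of "[]" 0] by (auto simp: bounded_iff)
    then show ?thesis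
      using fourier_inversion[of g C, OF _ _ _ fgi] schwartz_continuous_integrable[OF g, of "[]"] by simp
  qed
  finally show ?thesis by (simp add: D_def)
qed

text \<open>
  The triangle inequality is applied in the heat representation, after which all integrands are
  nonnegative and may be reordered. The right-hand side may be infinite.
\<close>
lemma norm_le_riesz_potential:
  fixes g :: "'a::euclidean_space \<Rightarrow> complex" and s :: real
  defines "n \<equiv> real DIM('a)"
  assumes g: "g \<in> schwartz" and s: "0 < s" "s < n"
  shows "ennreal (norm (g x)) \<le> ennreal (riesz_const n s / (Gamma (s/2) * pi powr (s/2) * 2 powr s))
     * (\<integral>\<^sup>+y. ennreal (norm (x - y) powr (s - n) * norm (frac_laplacian s g y)) \<partial>lborel)"
proof -
  define D where "D = Gamma (s/2) * pi powr (s/2) * 2 powr s"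
  have D: "D > 0" using s by (simp add: D_def Gamma_real_pos)
  define h where "h = frac_laplacian s g"
  have [measurable]: "g \<in> borel_measurable borel"
    using schwartz_continuous_integrable(1)[OF g, of "[]"] by (simp add: borel_measurable_continuous_onI)
  have [measurable]: "h \<in> borel_measurable borel"
    unfolding h_def frac_laplacian_def fourier_multiplier_def by measurable
  let ?F = "\<lambda>t. indicator {0<..} t *\<^sub>R (t powr (s/2 - 1) *\<^sub>R (LINT y|lborel. heat t (x - y) *\<^sub>R h y))"
  \<comment> \<open>For a nonintegrable function the Bochner integral is 0, so integrability need not be checked.\<close>
  have nb: "ennreal (norm (integral\<^sup>L M f)) \<le> (\<integral>\<^sup>+y. ennreal (norm (f y)) \<partial>M)" for M and f :: "'b \<Rightarrow> complex"
    by (cases "integrable M f") (auto simp: integral_norm_bound_ennreal not_integrable_integral_eq)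
  have "ennreal (D * norm (g x)) = ennreal (norm (LINT t|lborel. ?F t))"
    using frac_laplacian_heat_representation[OF g s(1), of x] D by (simp add: D_def h_def)
  also have "\<dots> \<le> (\<integral>\<^sup>+t. ennreal (norm (?F t)) \<partial>lborel)" by (rule nb)
  also have "\<dots> \<le> (\<integral>\<^sup>+t. (\<integral>\<^sup>+y. ennreal (t powr (s/2 - 1) * heat t (x - y)) * indicator {0<..} t * ennreal (norm (h y)) \<partial>lborel) \<partial>lborel)"
  proof (intro nn_integral_mono)
    fix t :: real
    have "ennreal (norm (?F t)) = ennreal (t powr (s/2 - 1)) * indicator {0<..} t * ennreal (norm (LINT y|lborel. heat t (x - y) *\<^sub>R h y))"
      by (auto simp: indicator_def ennreal_mult')
    also have "\<dots> \<le> ennreal (t powr (s/2 - 1)) * indicator {0<..} t * (\<integral>\<^sup>+y. ennreal (norm (heat t (x - y) *\<^sub>R h y)) \<partial>lborel)"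
      by (intro mult_left_mono nb) auto
    also have "\<dots> = (\<integral>\<^sup>+y. ennreal (t powr (s/2 - 1)) * indicator {0<..} t * ennreal (norm (heat t (x - y) *\<^sub>R h y)) \<partial>lborel)"
      by (simp add: nn_integral_cmult)
    also have "\<dots> = (\<integral>\<^sup>+y. ennreal (t powr (s/2 - 1) * heat t (x - y)) * indicator {0<..} t * ennreal (norm (h y)) \<partial>lborel)"
      by (intro nn_integral_cong) (simp add: ennreal_mult' mult_ac)
    finally show "ennreal (norm (?F t)) \<le> (\<integral>\<^sup>+y. ennreal (t powr (s/2 - 1) * heat t (x - y)) * indicator {0<..} t * ennreal (norm (h y)) \<partial>lborel)" .
  qed
  also have "\<dots> = (\<integral>\<^sup>+y. (\<integral>\<^sup>+t. ennreal (t powr (s/2 - 1) * heat t (x - y)) * indicator {0<..} t * ennreal (norm (h y)) \<partial>lborel) \<partial>lborel)"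
    by (rule lborel_pair.Fubini') measurable
  also have "\<dots> = (\<integral>\<^sup>+y. (\<integral>\<^sup>+t\<in>{0<..}. ennreal (t powr (s/2 - 1) * heat t (x - y)) \<partial>lborel) * ennreal (norm (h y)) \<partial>lborel)"
    by (simp add: nn_integral_multc)
  also have "\<dots> = (\<integral>\<^sup>+y. ennreal (riesz_const n s) * ennreal (norm (x - y) powr (s - n) * norm (h y)) \<partial>lborel)"
  proof (intro nn_integral_cong_AE)
    show "AE y in lborel. (\<integral>\<^sup>+t\<in>{0<..}. ennreal (t powr (s/2 - 1) * heat t (x - y)) \<partial>lborel) * ennreal (norm (h y))
       = ennreal (riesz_const n s) * ennreal (norm (x - y) powr (s - n) * norm (h y))"
      using AE_lborel_singleton[of x]
    proof eventually_elim
      case (elim y)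
      have "(\<integral>\<^sup>+t\<in>{0<..}. ennreal (t powr (s/2 - 1) * heat t (x - y)) \<partial>lborel) = ennreal (riesz_const n s * norm (x - y) powr (s - n))"
        using elim s unfolding n_def by (intro riesz_kernel_subordination) auto
      moreover have "riesz_const n s > 0" using s by (intro riesz_const_pos)
      ultimately show ?case by (simp add: ennreal_mult' less_imp_le mult.assoc)
    qed
  qed
  also have "\<dots> = ennreal (riesz_const n s) * (\<integral>\<^sup>+y. ennreal (norm (x - y) powr (s - n) * norm (h y)) \<partial>lborel)"
    by (simp add: nn_integral_cmult)
  finally have *: "ennreal (D * norm (g x)) \<le> \<dots>" .
  have "ennreal (norm (g x)) = ennreal (1 / D) * ennreal (D * norm (g x))"
    using D by (simp add: ennreal_mult'[symmetric])
  also have "\<dots> \<le> ennreal (1 / D) * (ennreal (riesz_const n s) * (\<integral>\<^sup>+y. ennreal (norm (x - y) powr (s - n) * norm (h y)) \<partial>lborel))"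
    by (intro mult_left_mono *) auto
  also have "\<dots> = ennreal (riesz_const n s / D) * (\<integral>\<^sup>+y. ennreal (norm (x - y) powr (s - n) * norm (h y)) \<partial>lborel)"
    using D by (simp add: mult.assoc[symmetric] ennreal_mult'[symmetric])
  finally show ?thesis by (simp add: D_def h_def)
qed

section \<open>The weighted inequality\<close>

text \<open>
  Hoelder's inequality for the measure with density \<open>k\<close> and the constant function 1, in the form
  used by Schur's test.
\<close>
lemma nn_integral_powr_le:
  fixes k q :: "'b \<Rightarrow> real"
  assumes p: "p > 1" and [measurable]: "k \<in> borel_measurable M" "q \<in> borel_measurable M"
    and k: "\<And>y. 0 \<le> k y" and q: "\<And>y. 0 \<le> q y" and G: "0 \<le> G" and m: "m > 0"
    and le: "ennreal G \<le> (\<integral>\<^sup>+y. ennreal (k y * q y) \<partial>M)" and km: "(\<integral>\<^sup>+y. ennreal (k y) \<partial>M) = ennreal m"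
  shows "ennreal (G powr p) \<le> ennreal (m powr (p - 1)) * (\<integral>\<^sup>+y. ennreal (k y * q y powr p) \<partial>M)"
proof (cases "\<integral>\<^sup>+y. ennreal (k y * q y powr p) \<partial>M")
  case top
  then show ?thesis using m by (simp add: ennreal_mult_top)
next
  case (real \<sigma>)
  \<comment> \<open>Young's inequality with a free parameter \<open>l\<close>; its best value recovers the geometric mean in
      Hoelder's inequality.\<close>
  have bound: "G \<le> l powr (1 - p) / p * \<sigma> + l * (1 - 1 / p) * m" if l: "l > 0" for l
  proof -
    have young: "q y \<le> q y powr p * l powr (1 - p) / p + l * (1 - 1 / p)" for y
    proof -
      have "q y = (q y * l powr (1 / p - 1)) * l powr (1 - 1 / p)"
        using l by (simp add: mult.assoc powr_add[symmetric])
      also have "\<dots> \<le> (q y * l powr (1 / p - 1)) powr p / p + (l powr (1 - 1 / p)) powr (1 / (1 - 1 / p)) / (1 / (1 - 1 / p))"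
        using p q by (intro Youngs_inequality) (auto simp: field_simps)
      also have "(l powr (1 - 1 / p)) powr (1 / (1 - 1 / p)) = l"
        using l p by (simp add: powr_powr)
      also have "(q y * l powr (1 / p - 1)) powr p = q y powr p * l powr (1 - p)"
      proof -
          have "(1 / p - 1) * p = 1 - p" using p by (simp add: field_simps)
          then show ?thesis using l q[of y] by (simp add: powr_mult powr_powr)
        qed
      finally show ?thesis by simp
    qed
    have "ennreal G \<le> (\<integral>\<^sup>+y. ennreal (l powr (1 - p) / p) * ennreal (k y * q y powr p) + ennreal (l * (1 - 1 / p)) * ennreal (k y) \<partial>M)"
    proof (rule order.trans[OF le], intro nn_integral_mono)
      fix y
      have "k y * q y \<le> k y * (q y powr p * l powr (1 - p) / p + l * (1 - 1 / p))"
        by (intro mult_left_mono young k)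
      then show "ennreal (k y * q y) \<le> ennreal (l powr (1 - p) / p) * ennreal (k y * q y powr p) + ennreal (l * (1 - 1 / p)) * ennreal (k y)"
      proof -
        let ?A = "l powr (1 - p) / p * (k y * q y powr p)" and ?B = "l * (1 - 1 / p) * k y"
        assume "k y * q y \<le> k y * (q y powr p * l powr (1 - p) / p + l * (1 - 1 / p))"
        also have "\<dots> = ?A + ?B" by (simp add: distrib_left mult_ac)
        finally have "ennreal (k y * q y) \<le> ennreal (?A + ?B)" by (rule ennreal_leI)
        also have "\<dots> = ennreal ?A + ennreal ?B"
          using p l k[of y] by (intro ennreal_plus mult_nonneg_nonneg) auto
        also have "ennreal ?A = ennreal (l powr (1 - p) / p) * ennreal (k y * q y powr p)"
          using p by (intro ennreal_mult') auto
        also have "ennreal ?B = ennreal (l * (1 - 1 / p)) * ennreal (k y)"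
          using p l by (intro ennreal_mult') auto
        finally show ?thesis .
      qed
    qed
    also have "\<dots> = ennreal (l powr (1 - p) / p) * ennreal \<sigma> + ennreal (l * (1 - 1 / p)) * ennreal m"
      by (simp add: nn_integral_add nn_integral_cmult real km)
    also have "\<dots> = ennreal (l powr (1 - p) / p * \<sigma> + l * (1 - 1 / p) * m)"
      using p l m real by (simp add: ennreal_mult'[symmetric] ennreal_plus[symmetric] del: ennreal_plus)
    finally show ?thesis
      using p l m real by (subst (asm) ennreal_le_iff) auto
  qed
  show ?thesis
  proof (cases "\<sigma> = 0")
    case True
    have "G \<le> 0"
    proof (rule field_le_epsilon)
      fix e :: real assume e: "e > 0"
      have "G \<le> e / m * (1 - 1 / p) * m" using bound[of "e / m"] e m True by simp
      also have "\<dots> = e * (1 - 1 / p)" using m by simp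
      also have "\<dots> \<le> e * 1" using e p by (intro mult_left_mono) auto
      finally show "G \<le> 0 + e" by simp
    qed
    then show ?thesis using G by simp
  next
    case False
    then have s: "\<sigma> > 0" using real by simp
    \<comment> \<open>The value of \<open>l\<close> at which both summands of the bound carry the same factor \<open>R\<close>.\<close>
    define l where "l = (\<sigma> / m) powr (1 / p)"
    have l: "l > 0" using s m by (simp add: l_def)
    define R where "R = \<sigma> powr (1 / p) * m powr (1 - 1 / p)"
    have 1: "l powr (1 - p) * \<sigma> = R"
    proof -
      have "l powr (1 - p) = (\<sigma> / m) powr (1 / p - 1)" using p by (simp add: l_def powr_powr field_simps)
      also have "\<dots> = \<sigma> powr (1 / p - 1) * m powr (1 - 1 / p)"
      proof -
        have "(\<sigma> / m) powr (1 / p - 1) = \<sigma> powr (1 / p - 1) / m powr (1 / p - 1)"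
          using s m by (simp add: powr_divide)
        also have "\<dots> = \<sigma> powr (1 / p - 1) * m powr (- (1 / p - 1))"
          by (simp only: powr_minus divide_inverse)
        finally show ?thesis by simp
      qed
      finally have "l powr (1 - p) * \<sigma> = (\<sigma> powr (1 / p - 1) * \<sigma> powr 1) * m powr (1 - 1 / p)" using s by simp
      then show ?thesis by (simp only: powr_add[symmetric] R_def) simp
    qed
    have 2: "l * m = R"
    proof -
      have "l * m = \<sigma> powr (1 / p) * (m powr 1 / m powr (1 / p))" using s m by (simp add: l_def powr_divide)
      then show ?thesis by (simp only: powr_diff[symmetric] R_def)
    qed
    have "G \<le> R / p + (1 - 1 / p) * R"
      using bound[OF l] by (simp only: 1[symmetric] 2[symmetric]) (metis 1 2 mult.assoc mult.commute times_divide_eq_left)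
    then have "G \<le> R" by (simp add: algebra_simps)
    then have "G powr p \<le> R powr p" using G p by (intro powr_mono2) auto
    also have "R powr p = m powr (p - 1) * \<sigma>"
      using s m p by (simp add: R_def powr_mult powr_powr algebra_simps)
    finally show ?thesis using real m by (simp add: ennreal_mult'[symmetric] ennreal_leI)
  qed
qed

text \<open>
  With \<open>r = n / p\<close> and \<open>q = n / p'\<close>, each row is treated by Hoelder's inequality with the
  density $k(y) = c|x|^{-\alpha}|x-y|^{s-n}|y|^{-\beta-r}$, whose integral is $cA|x|^{-r}$ by the
  composition formula. Since $r(p-1) = q$, integrating the result over $x$ leaves the column integral of
  $|x|^{-\alpha-q}|x-y|^{s-n}$, which is $A|y|^{\beta-q}$; all powers of $|y|$ except those in the
  norm on the right then cancel.
\<close>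
lemma stein_weiss_schur:
  fixes H G :: "'a::euclidean_space \<Rightarrow> real" and p r q \<alpha> \<beta> c n s :: real
  defines "n \<equiv> real DIM('a)" and "s \<equiv> \<alpha> + \<beta>"
  defines "A \<equiv> riesz_conv_const n s (q - \<beta>)"
  assumes p: "p > 1" and r: "r = n / p" and rq: "r + q = n" and s: "0 < s" "s < n" and \<alpha>: "\<alpha> < r" and \<beta>: "\<beta> < q"
    and [measurable]: "H \<in> borel_measurable borel" and H: "\<And>y. 0 \<le> H y" and G: "\<And>x. 0 \<le> G x" and c: "c > 0"
    and le: "\<And>x. ennreal (G x) \<le> ennreal c * (\<integral>\<^sup>+y. ennreal (norm (x - y) powr (s - n) * H y) \<partial>lborel)"
  shows "(\<integral>\<^sup>+x. ennreal ((norm x powr (-\<alpha>) * G x) powr p) \<partial>lborel)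
    \<le> ennreal ((c * A) powr p) * (\<integral>\<^sup>+y. ennreal ((norm y powr \<beta> * H y) powr p) \<partial>lborel)"
proof -
  have A: "A > 0" unfolding A_def using s \<alpha> \<beta> rq by (intro riesz_conv_const_pos) (auto simp: s_def)
  \<comment> \<open>The row and the column constants agree: the exponents only exchange two of the three Gamma factors.\<close>
  have AB: "riesz_conv_const n s (r - \<alpha>) = A"
  proof -
    have e: "n - s - (q - \<beta>) = r - \<alpha>" "n - s - (r - \<alpha>) = q - \<beta>" "n - (q - \<beta>) = s + (r - \<alpha>)" "n - (r - \<alpha>) = s + (q - \<beta>)"
      using rq by (auto simp: s_def)
    show ?thesis unfolding A_def riesz_conv_const_def e by (simp add: mult_ac)
  qed
  have rp: "r * p = n" using p r by simp
  have rp1: "r * (p - 1) = q" using rp rq by (simp add: algebra_simps)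
  let ?T = "\<lambda>y. (norm y powr \<beta> * H y) powr p"
  let ?K = "\<lambda>x y. norm x powr (- \<alpha> - q) * norm (x - y) powr (s - n) * norm y powr (q - \<beta>)"
  have point: "ennreal ((norm x powr (-\<alpha>) * G x) powr p) \<le> (\<integral>\<^sup>+y. ennreal ((c * A) powr (p - 1) * c * ?K x y * ?T y) \<partial>lborel)"
    if x: "x \<noteq> 0" for x
  proof -
    define k where "k = (\<lambda>y. c * norm x powr (-\<alpha>) * (norm (x - y) powr (s - n) * norm y powr (- \<beta> - r)))"
    define w where "w = (\<lambda>y. norm y powr (\<beta> + r) * H y)"
    have [measurable]: "k \<in> borel_measurable borel" "w \<in> borel_measurable borel" by (simp_all add: k_def w_def)
    have "ennreal ((norm x powr (-\<alpha>) * G x) powr p) \<le> ennreal ((c * A * norm x powr (- r)) powr (p - 1)) * (\<integral>\<^sup>+y. ennreal (k y * w y powr p) \<partial>lborel)"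
    proof (rule nn_integral_powr_le[OF p])
      show "ennreal (norm x powr (-\<alpha>) * G x) \<le> (\<integral>\<^sup>+y. ennreal (k y * w y) \<partial>lborel)"
      proof -
        have "ennreal (norm x powr (-\<alpha>) * G x) \<le> ennreal (norm x powr (-\<alpha>)) * (ennreal c * (\<integral>\<^sup>+y. ennreal (norm (x - y) powr (s - n) * H y) \<partial>lborel))"
          by (subst ennreal_mult') (auto intro!: mult_left_mono le)
        also have "\<dots> = (\<integral>\<^sup>+y. ennreal (norm x powr (-\<alpha>) * c) * ennreal (norm (x - y) powr (s - n) * H y) \<partial>lborel)"
          using c by (simp add: nn_integral_cmult ennreal_mult' mult.assoc)
        also have "\<dots> = (\<integral>\<^sup>+y. ennreal (k y * w y) \<partial>lborel)"
        proof (intro nn_integral_cong_AE)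
          show "AE y in lborel. ennreal (norm x powr (-\<alpha>) * c) * ennreal (norm (x - y) powr (s - n) * H y) = ennreal (k y * w y)"
            using AE_lborel_singleton[of 0]
          proof eventually_elim
            case (elim y)
            have "norm y powr (- \<beta> - r) * norm y powr (\<beta> + r) = 1"
              using elim by (simp add: powr_add[symmetric])
            then have "k y * w y = norm x powr (-\<alpha>) * c * (norm (x - y) powr (s - n) * H y)"
              by (simp add: k_def w_def mult_ac)
            then show ?case using c by (simp add: ennreal_mult'[symmetric])
          qed
        qed
        finally show ?thesis .
      qed
      have "(\<integral>\<^sup>+y. ennreal (k y) \<partial>lborel) = ennreal (c * norm x powr (-\<alpha>)) * (\<integral>\<^sup>+y. ennreal (norm (x - y) powr (s - n) * norm y powr ((q - \<beta>) - n)) \<partial>lborel)"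
      proof -
        have e: "q - \<beta> - n = - \<beta> - r" using rq by simp
        show ?thesis using c unfolding e k_def by (simp add: ennreal_mult' nn_integral_cmult)
      qed
      also have "\<dots> = ennreal (c * norm x powr (-\<alpha>)) * ennreal (A * norm x powr (s + (q - \<beta>) - n))"
        using s \<alpha> \<beta> rq x unfolding A_def n_def by (subst riesz_kernel_convolution) (auto simp: s_def)
      also have "\<dots> = ennreal (c * A * (norm x powr (-\<alpha>) * norm x powr (s + (q - \<beta>) - n)))"
        using c by (simp add: ennreal_mult'[symmetric] mult_ac)
      also have "norm x powr (-\<alpha>) * norm x powr (s + (q - \<beta>) - n) = norm x powr (- r)"
      proof -
        have "-\<alpha> + (s + (q - \<beta>) - n) = - r" using rq by (simp add: s_def)
        then show ?thesis by (simp only: powr_add[symmetric])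
      qed
      finally show "(\<integral>\<^sup>+y. ennreal (k y) \<partial>lborel) = ennreal (c * A * norm x powr (- r))" .
    qed (use c A x H G in \<open>auto simp: k_def w_def\<close>)
    also have "\<dots> = (\<integral>\<^sup>+y. ennreal ((c * A * norm x powr (- r)) powr (p - 1)) * ennreal (k y * w y powr p) \<partial>lborel)"
      by (simp add: nn_integral_cmult)
    also have "\<dots> = (\<integral>\<^sup>+y. ennreal ((c * A) powr (p - 1) * c * ?K x y * ?T y) \<partial>lborel)"
    proof (rule nn_integral_cong)
      fix y
      have 1: "(c * A * norm x powr (- r)) powr (p - 1) = (c * A) powr (p - 1) * norm x powr (- q)"
        using c A rp1 by (simp add: powr_mult powr_powr)
      have "w y = norm y powr r * (norm y powr \<beta> * H y)"
        by (simp add: w_def powr_add mult_ac)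
      then have 2: "w y powr p = norm y powr n * ?T y"
        using H[of y] rp by (simp add: powr_mult[of "norm y powr r"] powr_powr)
      have 3: "norm x powr (-\<alpha>) * norm x powr (- q) = norm x powr (- \<alpha> - q)"
        by (simp add: powr_add[symmetric])
      have 4: "norm y powr (- \<beta> - r) * norm y powr n = norm y powr (q - \<beta>)"
      proof -
        have "(- \<beta> - r) + n = q - \<beta>" using rq by simp
        then show ?thesis by (simp only: powr_add[symmetric])
      qed
      have "(c * A * norm x powr (- r)) powr (p - 1) * (k y * w y powr p) = (c * A) powr (p - 1) * c * ?K x y * ?T y"
        unfolding 1 2 k_def 3[symmetric] 4[symmetric] by (simp only: mult_ac)
      then show "ennreal ((c * A * norm x powr (- r)) powr (p - 1)) * ennreal (k y * w y powr p) = ennreal ((c * A) powr (p - 1) * c * ?K x y * ?T y)"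
        by (simp only: ennreal_mult'[symmetric] powr_ge_zero)
    qed
    finally show ?thesis .
  qed
  have "(\<integral>\<^sup>+x. ennreal ((norm x powr (-\<alpha>) * G x) powr p) \<partial>lborel)
     \<le> (\<integral>\<^sup>+x. (\<integral>\<^sup>+y. ennreal ((c * A) powr (p - 1) * c * ?K x y * ?T y) \<partial>lborel) \<partial>lborel)"
    using AE_lborel_singleton[of 0] by (intro nn_integral_mono_AE) (auto elim!: eventually_mono point)
  also have "\<dots> = (\<integral>\<^sup>+y. (\<integral>\<^sup>+x. ennreal ((c * A) powr (p - 1) * c * ?K x y * ?T y) \<partial>lborel) \<partial>lborel)"
    by (rule lborel_pair.Fubini') measurable
  also have "\<dots> = (\<integral>\<^sup>+y. ennreal ((c * A) powr p) * ennreal (?T y) \<partial>lborel)"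
  proof (intro nn_integral_cong_AE)
    show "AE y in lborel. (\<integral>\<^sup>+x. ennreal ((c * A) powr (p - 1) * c * ?K x y * ?T y) \<partial>lborel) = ennreal ((c * A) powr p) * ennreal (?T y)"
      using AE_lborel_singleton[of 0]
    proof eventually_elim
      case (elim y)
      let ?C = "(c * A) powr (p - 1) * c * norm y powr (q - \<beta>) * ?T y"
      have e: "r - \<alpha> - n = - \<alpha> - q" using rq by simp
      have "(\<integral>\<^sup>+x. ennreal ((c * A) powr (p - 1) * c * ?K x y * ?T y) \<partial>lborel)
        = (\<integral>\<^sup>+x. ennreal ?C * ennreal (norm (y - x) powr (s - n) * norm x powr (r - \<alpha> - n)) \<partial>lborel)"
        using c by (intro nn_integral_cong) (simp add: e ennreal_mult'[symmetric] norm_minus_commute mult_ac)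
      also have "\<dots> = ennreal ?C * (\<integral>\<^sup>+x. ennreal (norm (y - x) powr (s - n) * norm x powr (r - \<alpha> - n)) \<partial>lborel)"
        by (rule nn_integral_cmult) measurable
      also have "(\<integral>\<^sup>+x. ennreal (norm (y - x) powr (s - n) * norm x powr (r - \<alpha> - n)) \<partial>lborel) = ennreal (A * norm y powr (s + (r - \<alpha>) - n))"
        using s \<alpha> \<beta> rq elim unfolding AB[symmetric] n_def by (intro riesz_kernel_convolution) (auto simp: s_def)
      also have "ennreal ?C * \<dots> = ennreal (?C * (A * norm y powr (s + (r - \<alpha>) - n)))"
        using c by (intro ennreal_mult'[symmetric]) simp
      also have "?C * (A * norm y powr (s + (r - \<alpha>) - n)) = (c * A) powr p * ?T y"
      proof -
        have "q - \<beta> + (s + (r - \<alpha>) - n) = 0" using rq by (simp add: s_def)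
        then have 1: "norm y powr (q - \<beta>) * norm y powr (s + (r - \<alpha>) - n) = 1"
          using elim by (simp add: powr_add[symmetric])
        have 2: "(c * A) powr (p - 1) * (c * A) = (c * A) powr p"
          using c A powr_add[of "c * A" "p - 1" 1] by simp
        have "?C * (A * norm y powr (s + (r - \<alpha>) - n)) = ((c * A) powr (p - 1) * (c * A)) * (norm y powr (q - \<beta>) * norm y powr (s + (r - \<alpha>) - n)) * ?T y"
          by (simp only: mult_ac)
        then show ?thesis unfolding 1 2 by simp
      qed
      finally show ?case by (simp only: ennreal_mult' powr_ge_zero)
    qed
  qed
  also have "\<dots> = ennreal ((c * A) powr p) * (\<integral>\<^sup>+y. ennreal (?T y) \<partial>lborel)"
    by (rule nn_integral_cmult) measurable
  finally show ?thesis .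
qed

text \<open>
  If the norm on the right is infinite, positivity of the constant makes the bound trivial.
\<close>
lemma Lp_norm_le:
  assumes p: "p > 0" and C: "C > 0"
    and le: "(\<integral>\<^sup>+x. ennreal (norm (f x) powr p) \<partial>lborel) \<le> ennreal (C powr p) * (\<integral>\<^sup>+x. ennreal (norm (F x) powr p) \<partial>lborel)"
  shows "Lp_norm p f \<le> ennreal C * Lp_norm p F"
proof (cases "(\<integral>\<^sup>+x. ennreal (norm (F x) powr p) \<partial>lborel)")
  case top
  then show ?thesis using C by (simp add: Lp_norm_def ennreal_mult_top)
next
  case (real J)
  then have "(\<integral>\<^sup>+x. ennreal (norm (f x) powr p) \<partial>lborel) \<le> ennreal (C powr p * J)"
    using le by (simp add: ennreal_mult'[symmetric])
  then obtain I where I: "(\<integral>\<^sup>+x. ennreal (norm (f x) powr p) \<partial>lborel) = ennreal I" "0 \<le> I"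
    by (cases "\<integral>\<^sup>+x. ennreal (norm (f x) powr p) \<partial>lborel") (auto simp: top_unique)
  with \<open>_ \<le> ennreal (C powr p * J)\<close> have "I \<le> C powr p * J"
    using real by simp
  then have "I powr (1/p) \<le> (C powr p * J) powr (1/p)" using I p by (intro powr_mono2) auto
  also have "\<dots> = C * J powr (1/p)" using C p real by (simp add: powr_mult powr_powr)
  finally show ?thesis
    using I real C by (simp add: Lp_norm_def ennreal_mult'[symmetric] ennreal_leI)
qed

theorem theorem3:
  fixes p p' \<alpha> \<beta> n :: real
    and g :: "'a::euclidean_space \<Rightarrow> complex"
  defines "n \<equiv> real DIM('a)"
  assumes "1 < p" and "1 / p + 1 / p' = 1"
    and "0 < \<alpha> + \<beta>" and "\<alpha> + \<beta> < n"
    and "\<alpha> < n / p" and "\<beta> < n / p'"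
    and "g \<in> schwartz"
  shows "Lp_norm p (\<lambda>x. of_real (norm x powr (- \<alpha>)) * g x)
    \<le> ennreal (2 powr (- (\<alpha> + \<beta>)) *
        (Gamma (n / (2 * p) - \<alpha> / 2) * Gamma (n / (2 * p') - \<beta> / 2) /
         (Gamma (n / (2 * p') + \<alpha> / 2) * Gamma (n / (2 * p) + \<beta> / 2))))
      * Lp_norm p (\<lambda>x. of_real (norm x powr \<beta>) * frac_laplacian (\<alpha> + \<beta>) g x)"
    (is "_ \<le> ennreal ?const * _")
proof -
  define s where "s = \<alpha> + \<beta>"
  define r q where "r = n / p" and "q = n / p'"
  define h where "h = frac_laplacian s g"
  define D where "D = Gamma (s/2) * pi powr (s/2) * 2 powr s"
  define c where "c = riesz_const n s / D"
  define A where "A = riesz_conv_const n s (q - \<beta>)"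
  have s: "0 < s" "s < n" using assms by (auto simp: s_def)
  have \<alpha>: "\<alpha> < r" and \<beta>: "\<beta> < q" using assms by (auto simp: r_def q_def)
  have rq: "r + q = n"
  proof -
    have "r + q = n * (1 / p + 1 / p')" by (simp add: r_def q_def distrib_left)
    then show ?thesis using assms by simp
  qed
  have D: "D > 0" using s by (simp add: D_def Gamma_real_pos)
  have c: "c > 0" using s D by (simp add: c_def riesz_const_pos)
  have A: "A > 0" unfolding A_def using s \<alpha> \<beta> rq by (intro riesz_conv_const_pos) (auto simp: s_def)
  have [measurable]: "g \<in> borel_measurable borel"
    using schwartz_continuous_integrable(1)[OF \<open>g \<in> schwartz\<close>, of "[]"] by (simp add: borel_measurable_continuous_onI)
  have [measurable]: "h \<in> borel_measurable borel"
    unfolding h_def frac_laplacian_def fourier_multiplier_def by measurable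
  have const: "c * A = ?const"
  proof -
    have e: "n - (q - \<beta>) = r + \<beta>" "s + (q - \<beta>) = q + \<alpha>" "n - s - (q - \<beta>) = r - \<alpha>"
      using rq by (auto simp: s_def)
    have G: "Gamma (s/2) > 0" "Gamma ((n - s)/2) > 0" using s by (auto intro!: Gamma_real_pos)
    have "pi powr (n/2) = pi powr ((n - s)/2) * pi powr (s/2)"
      by (simp add: powr_add[symmetric] add_divide_distrib[symmetric])
    then have "c * A = (1 / 2 powr s) * (Gamma ((r - \<alpha>)/2) * Gamma ((q - \<beta>)/2) / (Gamma ((q + \<alpha>)/2) * Gamma ((r + \<beta>)/2)))"
      unfolding c_def A_def D_def riesz_const_def riesz_conv_const_def e using G by (simp add: mult_ac)
    moreover have "1 / 2 powr s = 2 powr (- (\<alpha> + \<beta>))" by (simp only: powr_minus_divide s_def)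
    moreover have "(r - \<alpha>)/2 = n / (2 * p) - \<alpha> / 2" "(q - \<beta>)/2 = n / (2 * p') - \<beta> / 2"
      "(q + \<alpha>)/2 = n / (2 * p') + \<alpha> / 2" "(r + \<beta>)/2 = n / (2 * p) + \<beta> / 2"
      by (simp_all add: r_def q_def diff_divide_distrib add_divide_distrib)
    ultimately show ?thesis by (simp only:)
  qed
  have "(\<integral>\<^sup>+x. ennreal ((norm x powr (-\<alpha>) * norm (g x)) powr p) \<partial>lborel)
    \<le> ennreal ((c * A) powr p) * (\<integral>\<^sup>+y. ennreal ((norm y powr \<beta> * norm (h y)) powr p) \<partial>lborel)"
    unfolding A_def s_def n_def
  proof (rule stein_weiss_schur)
    fix x :: 'a
    show "ennreal (norm (g x)) \<le> ennreal c * (\<integral>\<^sup>+y. ennreal (norm (x - y) powr (\<alpha> + \<beta> - real DIM('a)) * norm (h y)) \<partial>lborel)"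
      using norm_le_riesz_potential[OF \<open>g \<in> schwartz\<close>, of s x] s by (simp add: n_def c_def D_def h_def s_def)
  qed (use assms s \<alpha> \<beta> rq c in \<open>auto simp: n_def s_def r_def\<close>)
  then have "Lp_norm p (\<lambda>x. of_real (norm x powr (- \<alpha>)) * g x) \<le> ennreal (c * A) * Lp_norm p (\<lambda>x. of_real (norm x powr \<beta>) * h x)"
    using assms c A by (intro Lp_norm_le) (auto simp: norm_mult)
  then show ?thesis by (simp only: const h_def s_def)
qed

end
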